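(* There are universal constants $c,c'>0$ such that for any $M,K,R\ge1$, $H,\Delta,\lambda>0$ and $\sigma\ge0$, either Minibatch AC-SA or Single-Machine AC-SA (in the multi-stage form for strongly convex objectives, with suitably chosen parameters, in the homogeneous intermittent communication setting) guarantees that for any $F_\lambda\in\mathcal{F}_\lambda(H,\Delta)$ $$\mathbb{E}F_\lambda(\hat x)-F_\lambda^*\le c\left(\Delta e^{-\frac{c'\sqrt\lambda KR}{\sqrt H}}+\min\left\{\frac{\sigma^2}{\lambda MKR},\Delta\right\}+\min\left\{\frac{\sigma^2}{\lambda KR},\ \Delta e^{-\frac{c'\sqrt\lambda R}{\sqrt H}}\right\}\right).$$
   Context: $\mathcal{F}_\lambda(H,\Delta)$: $\lambda$-strongly convex, $H$-smooth (gradient $H$-Lipschitz) functions $F:\mathbb{R}^d\to\mathbb{R}$, $d\in\mathbb N$, with $F(0)-\min_xF(x)\le\Delta$. $F^*=\min F$. Homogeneous intermittent communication setting: $M$ machines, $R$ rounds of communication, $K$ oracle queries per machine per round. Each query at $x$ returns an independent stochastic gradient with mean $\nabla F(x)$ and variance $\mathbb{E}\|\cdot-\nabla F(x)\|^2\le\sigma^2$. AC-SA with $T$ iterations from a starting point $x_0$ and stochastic gradients $g_t(\cdot)$: $x^{\mathrm{ag}}_0=x_0$; for $t=0,\dots,T-1$: $x^{\mathrm{md}}_{t+1}=\beta_t^{-1}x_t+(1-\beta_t^{-1})x^{\mathrm{ag}}_t$; $x_{t+1}=x_t-\gamma_t\,g_t(x^{\mathrm{md}}_{t+1})$; $x^{\mathrm{ag}}_{t+1}=\beta_t^{-1}x_{t+1}+(1-\beta_t^{-1})x^{\mathrm{ag}}_t$;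 output $x^{\mathrm{ag}}_T$. The parameters $\beta_t\ge1,\gamma_t\ge0$ may depend on $H,\lambda,\Delta,\sigma,M,K,R$. For strongly convex objectives AC-SA is run in multi-stage form: the iterations are split into consecutive stages, the first started at $0$ and each later stage being AC-SA restarted at the output of the previous stage, with stage lengths and parameters chosen from the problem parameters; $\hat x$ is the output of the last stage. Minibatch AC-SA: $R$ iterations in total, each using the average of the $MK$ stochastic gradients computed by all machines in one round at the same point. Single-Machine AC-SA: $KR$ iterations in total with single stochastic gradients, run on one machine, ignoring the others. *)

theory Defs
  imports "HOL-Probability.Probability"
begin

text \<open>
  The constants of the theorem and the parameters of the algorithms must not depend on the
  dimension, so the dimension has to be an ordinary natural number that is quantified inside the
  statement. Points of d-dimensional Euclidean space are therefore extensional functions on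
  \<open>{..<d}\<close>, that is, the elements of the finite product space below, with Euclidean norm
  \<open>L2_set _ {..<d}\<close>.
\<close>

abbreviation Rd :: "nat \<Rightarrow> (nat \<Rightarrow> real) measure" where
  "Rd d \<equiv> PiM {..<d} (\<lambda>_. borel)"

abbreviation rvec :: "nat \<Rightarrow> (nat \<Rightarrow> real) set" where
  "rvec d \<equiv> PiE {..<d} (\<lambda>_. UNIV)"

definition origin :: "nat \<Rightarrow> nat \<Rightarrow> real" where
  "origin d = (\<lambda>i\<in>{..<d}. 0)"

definition vdist :: "nat \<Rightarrow> (nat \<Rightarrow> real) \<Rightarrow> (nat \<Rightarrow> real) \<Rightarrow> real" where
  "vdist d x y = L2_set (\<lambda>i. x i - y i) {..<d}"

definition mix :: "nat \<Rightarrow> real \<Rightarrow> (nat \<Rightarrow> real) \<Rightarrow> (nat \<Rightarrow> real) \<Rightarrow> nat \<Rightarrow> real" where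
  "mix d a x y = (\<lambda>i\<in>{..<d}. a * x i + (1 - a) * y i)"


subsection \<open>The function class\<close>

definition has_gradient ::
  "nat \<Rightarrow> ((nat \<Rightarrow> real) \<Rightarrow> real) \<Rightarrow> (nat \<Rightarrow> real) \<Rightarrow> (nat \<Rightarrow> real) \<Rightarrow> bool" where
  "has_gradient d F g x \<longleftrightarrow>
     (\<forall>e>0. \<exists>r>0. \<forall>y\<in>rvec d. vdist d y x < r \<longrightarrow>
        \<bar>F y - F x - (\<Sum>i<d. g i * (y i - x i))\<bar> \<le> e * vdist d y x)"

definition smooth :: "nat \<Rightarrow> real \<Rightarrow> ((nat \<Rightarrow> real) \<Rightarrow> real) \<Rightarrow> bool" where
  "smooth d H F \<longleftrightarrow>
     (\<exists>G. (\<forall>x\<in>rvec d. has_gradient d F (G x) x) \<and>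
          (\<forall>x\<in>rvec d. \<forall>y\<in>rvec d. vdist d (G x) (G y) \<le> H * vdist d x y))"

definition strongly_convex :: "nat \<Rightarrow> real \<Rightarrow> ((nat \<Rightarrow> real) \<Rightarrow> real) \<Rightarrow> bool" where
  "strongly_convex d l F \<longleftrightarrow>
     (\<forall>x\<in>rvec d. \<forall>y\<in>rvec d. \<forall>a\<in>{0..1}.
        F (mix d a x y) \<le> a * F x + (1 - a) * F y - l / 2 * a * (1 - a) * (vdist d x y)\<^sup>2)"

text \<open>For the smooth strongly convex functions considered here the infimum is attained.\<close>

definition opt_val :: "nat \<Rightarrow> ((nat \<Rightarrow> real) \<Rightarrow> real) \<Rightarrow> real" where
  "opt_val d F = (INF x\<in>rvec d. F x)"

definition fun_class :: "nat \<Rightarrow> real \<Rightarrow> real \<Rightarrow> real \<Rightarrow> ((nat \<Rightarrow> real) \<Rightarrow> real) set" where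
  "fun_class d l H \<Delta> =
     {F. strongly_convex d l F \<and> smooth d H F \<and> F (origin d) - opt_val d F \<le> \<Delta>}"


subsection \<open>Stochastic gradient oracles\<close>

text \<open>
  A stochastic gradient source is a Markov kernel: a query at \<open>x\<close> returns a sample from the distribution \<open>Q x\<close> that is
  independent of everything else. It is the same for all machines (homogeneous setting).
\<close>

type_synonym vkernel = "(nat \<Rightarrow> real) \<Rightarrow> (nat \<Rightarrow> real) measure"

definition grad_oracle :: "nat \<Rightarrow> ((nat \<Rightarrow> real) \<Rightarrow> real) \<Rightarrow> real \<Rightarrow> vkernel \<Rightarrow> bool" where
  "grad_oracle d F \<sigma> Q \<longleftrightarrow>
     Q \<in> Rd d \<rightarrow>\<^sub>M prob_algebra (Rd d) \<and>
     (\<forall>x\<in>rvec d. \<exists>g. has_gradient d F g x \<and>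
        (\<forall>i<d. integrable (Q x) (\<lambda>z. z i) \<and> (LINT z|Q x. z i) = g i) \<and>
        integrable (Q x) (\<lambda>z. (vdist d z g)\<^sup>2) \<and>
        (LINT z|Q x. (vdist d z g)\<^sup>2) \<le> \<sigma>\<^sup>2)"

text \<open>Average of the independent answers to \<open>K\<close> queries on each of \<open>M\<close> machines at the same point.\<close>

definition minibatch :: "nat \<Rightarrow> nat \<Rightarrow> nat \<Rightarrow> vkernel \<Rightarrow> vkernel" where
  "minibatch d M K Q x =
     distr (PiM ({..<M} \<times> {..<K}) (\<lambda>_. Q x)) (Rd d)
       (\<lambda>z. \<lambda>i\<in>{..<d}. (\<Sum>p\<in>{..<M} \<times> {..<K}. z p i) / (real M * real K))"


subsection \<open>Multi-stage AC-SA\<close>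

text \<open>Joint distribution of \<open>(x\<^sub>t, x\<^sub>t\<^sup>a\<^sup>g)\<close> for AC-SA started at \<open>x0\<close>.\<close>

primrec acsa :: "nat \<Rightarrow> vkernel \<Rightarrow> (nat \<Rightarrow> real) \<Rightarrow> (nat \<Rightarrow> real) \<Rightarrow> (nat \<Rightarrow> real) \<Rightarrow> nat \<Rightarrow>
    ((nat \<Rightarrow> real) \<times> (nat \<Rightarrow> real)) measure" where
  "acsa d Q \<beta> \<gamma> x0 0 = return (Rd d \<Otimes>\<^sub>M Rd d) (x0, x0)"
| "acsa d Q \<beta> \<gamma> x0 (Suc t) =
     acsa d Q \<beta> \<gamma> x0 t \<bind> (\<lambda>(x, ag).
       Q (mix d (1 / \<beta> t) x ag) \<bind> (\<lambda>g.
         let x' = (\<lambda>i\<in>{..<d}. x i - \<gamma> t * g i)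
         in return (Rd d \<Otimes>\<^sub>M Rd d) (x', mix d (1 / \<beta> t) x' ag)))"

text \<open>A stage consists of its length and its parameter sequences \<open>\<beta>\<close> and \<open>\<gamma>\<close>.\<close>

type_synonym stage = "nat \<times> (nat \<Rightarrow> real) \<times> (nat \<Rightarrow> real)"

definition valid_schedule :: "nat \<Rightarrow> stage list \<Rightarrow> bool" where
  "valid_schedule N ss \<longleftrightarrow>
     (\<forall>(T, \<beta>, \<gamma>)\<in>set ss. T \<ge> 1 \<and> (\<forall>t<T. \<beta> t \<ge> 1 \<and> \<gamma> t \<ge> 0)) \<and>
     (\<Sum>s\<leftarrow>ss. fst s) = N"

text \<open>Distribution of the output of the last stage when the first one is started at the given point.\<close>

primrec multi_acsa :: "nat \<Rightarrow> vkernel \<Rightarrow> stage list \<Rightarrow> (nat \<Rightarrow> real) \<Rightarrow> (nat \<Rightarrow> real) measure" where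
  "multi_acsa d Q [] x0 = return (Rd d) x0"
| "multi_acsa d Q (s # ss) x0 =
     (case s of (T, \<beta>, \<gamma>) \<Rightarrow> distr (acsa d Q \<beta> \<gamma> x0 T) (Rd d) snd) \<bind> multi_acsa d Q ss"

definition minibatch_acsa :: "nat \<Rightarrow> nat \<Rightarrow> nat \<Rightarrow> stage list \<Rightarrow> vkernel \<Rightarrow> (nat \<Rightarrow> real) measure" where
  "minibatch_acsa d M K ss Q = multi_acsa d (minibatch d M K Q) ss (origin d)"

definition single_machine_acsa :: "nat \<Rightarrow> stage list \<Rightarrow> vkernel \<Rightarrow> (nat \<Rightarrow> real) measure" where
  "single_machine_acsa d ss Q = multi_acsa d Q ss (origin d)"

text \<open>
  Guarantee in every dimension, for every function of the class and all oracles. Integrability is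
  required explicitly since the Bochner integral of a non-integrable function is zero.
\<close>

definition guarantees :: "(nat \<Rightarrow> vkernel \<Rightarrow> (nat \<Rightarrow> real) measure) \<Rightarrow>
    real \<Rightarrow> real \<Rightarrow> real \<Rightarrow> real \<Rightarrow> real \<Rightarrow> bool" where
  "guarantees alg H l \<Delta> \<sigma> B \<longleftrightarrow>
     (\<forall>d. \<forall>F\<in>fun_class d l H \<Delta>. \<forall>Q. grad_oracle d F \<sigma> Q \<longrightarrow>
        integrable (alg d Q) F \<and> (LINT x|alg d Q. F x) - opt_val d F \<le> B)"

end

theory Submission
  imports Defs
begin

text \<open>
  For a source with variance \<open>s\<^sup>2\<close>, a stage of \<open>T\<close> steps with \<open>\<beta>\<^sub>t = (t + 2) / 2\<close> and
  \<open>\<gamma>\<^sub>t = \<gamma> (t + 1) / 2\<close>, where \<open>H \<gamma> \<le> 1\<close>, is controlled by the potential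
  \<open>t (t + 1) (F x\<^sup>a\<^sup>g - F\<^sup>*) + (2 / \<gamma>) |x - u|\<^sup>2\<close>, which grows in expectation by at most
  \<open>2 (t + 1) (F u - F\<^sup>*) + \<gamma> (t + 1)\<^sup>2 s\<^sup>2\<close> per step. Nearly optimal \<open>u\<close> suffice, so no minimiser is
  needed. Strong convexity bounds \<open>|x - u|\<^sup>2\<close> by the initial gap; with \<open>\<gamma> = 32 / (l T\<^sup>2)\<close> and
  \<open>T \<ge> 6 sqrt (H / l)\<close> a stage therefore maps a gap \<open>G\<close> to at most \<open>G / 4 + 16 s\<^sup>2 / (l T)\<close>.
  Half of the budget is spent on stages of the minimal length \<open>n\<close>, which contract the initial gap
  exponentially down to the noise level \<open>s\<^sup>2 / (l n)\<close>, the other half on stages of doubling length,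
  which bring the noise term down to \<open>s\<^sup>2 / (l N)\<close>.

  If \<open>\<sigma>\<^sup>2 / (l K R)\<close> is below the exponential \<open>\<Delta> exp (- c' R sqrt (l / H))\<close>, the single machine is
  used. Otherwise the minibatch variant is used, or no step is made at all if even its noise term
  exceeds \<open>\<Delta>\<close>.
\<close>

subsection \<open>Smooth strongly convex functions\<close>

lemma vdist_square: "(vdist d x y)\<^sup>2 = (\<Sum>i<d. (x i - y i)\<^sup>2)"
  by (simp add: vdist_def L2_set_def sum_nonneg)

lemma vdist_nonneg [simp]: "0 \<le> vdist d x y"
  by (simp add: vdist_def)

lemma mix_rvec [simp]: "mix d a x y \<in> rvec d"
  by (simp add: mix_def)

lemma origin_rvec [simp]: "origin d \<in> rvec d"
  by (simp add: origin_def)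

lemma mix_0: "y \<in> rvec d \<Longrightarrow> mix d 0 x y = y"
  by (auto simp: mix_def fun_eq_iff PiE_def extensional_def)

lemma mix_1: "x \<in> rvec d \<Longrightarrow> mix d 1 x y = x"
  by (auto simp: mix_def fun_eq_iff PiE_def extensional_def)

lemma vdist_mix_mix: "vdist d (mix d s y x) (mix d t y x) = \<bar>s - t\<bar> * vdist d y x"
proof -
  have "(\<Sum>i<d. (mix d s y x i - mix d t y x i)\<^sup>2) = (\<Sum>i<d. (s - t)\<^sup>2 * (y i - x i)\<^sup>2)"
    by (intro sum.cong) (auto simp: mix_def power2_eq_square algebra_simps)
  then show ?thesis
    by (simp add: vdist_def L2_set_def sum_distrib_left[symmetric] real_sqrt_mult)
qed

section \<open>Derivatives along segments and the first-order lower and upper bounds\<close>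

lemma has_gradient_line_derivative:
  assumes "has_gradient d F g (mix d t y x)"
  shows "((\<lambda>s. F (mix d s y x)) has_real_derivative (\<Sum>i<d. g i * (y i - x i))) (at t)"
  unfolding has_field_derivative_def has_derivative_at_alt
proof (intro conjI allI impI)
  show "bounded_linear ((*) (\<Sum>i<d. g i * (y i - x i)))"
    by (rule bounded_linear_mult_right)
  fix e :: real assume e: "0 < e"
  let ?V = "vdist d y x"
  have V: "0 \<le> ?V" by simp
  \<comment> \<open>Along the segment the distance is \<open>\<bar>s - t\<bar> * ?V\<close>, so the
    gradient accuracy is rescaled by the length. Dividing by \<open>?V + 1\<close> instead of
    \<open>?V\<close> also covers \<open>y = x\<close>.\<close>
  have "0 < e / (?V + 1)" using e V by (intro divide_pos_pos) linarith+
  with assms[unfolded has_gradient_def] obtain r where r: "r > 0" and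
    *: "\<And>z. z \<in> rvec d \<Longrightarrow> vdist d z (mix d t y x) < r \<Longrightarrow>
      \<bar>F z - F (mix d t y x) - (\<Sum>i<d. g i * (z i - mix d t y x i))\<bar>
        \<le> e / (?V + 1) * vdist d z (mix d t y x)"
    by meson
  show "\<exists>r>0. \<forall>s. norm (s - t) < r \<longrightarrow>
    norm (F (mix d s y x) - F (mix d t y x) - (\<Sum>i<d. g i * (y i - x i)) * (s - t)) \<le> e * norm (s - t)"
  proof (intro exI[of _ "r / (?V + 1)"] conjI allI impI)
    show "0 < r / (?V + 1)" using r V by (intro divide_pos_pos) linarith+
    fix s assume "norm (s - t) < r / (?V + 1)"
    then have "\<bar>s - t\<bar> * (?V + 1) < r" using V by (simp add: pos_less_divide_eq)
    then have "\<bar>s - t\<bar> * ?V < r" using V by (simp add: algebra_simps)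
    from *[OF mix_rvec, of s y x, unfolded vdist_mix_mix, OF this]
    have "\<bar>F (mix d s y x) - F (mix d t y x) - (\<Sum>i<d. g i * (mix d s y x i - mix d t y x i))\<bar>
        \<le> e / (?V + 1) * (\<bar>s - t\<bar> * ?V)" .
    also have "(\<Sum>i<d. g i * (mix d s y x i - mix d t y x i)) = (\<Sum>i<d. g i * (y i - x i)) * (s - t)"
      unfolding sum_distrib_right by (intro sum.cong) (auto simp: mix_def algebra_simps)
    also have "e / (?V + 1) * (\<bar>s - t\<bar> * ?V) = (?V / (?V + 1)) * (e * \<bar>s - t\<bar>)"
      by simp
    also have "\<dots> \<le> 1 * (e * \<bar>s - t\<bar>)"
      using e V by (intro mult_right_mono) (simp_all add: add_nonneg_pos pos_divide_le_eq)
    finally show "norm (F (mix d s y x) - F (mix d t y x) - (\<Sum>i<d. g i * (y i - x i)) * (s - t))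
        \<le> e * norm (s - t)" by simp
  qed
qed

lemma strongly_convexD:
  assumes "strongly_convex d l F" "x \<in> rvec d" "y \<in> rvec d" "0 \<le> a" "a \<le> 1"
  shows "F (mix d a x y) \<le> a * F x + (1 - a) * F y - l / 2 * a * (1 - a) * (vdist d x y)\<^sup>2"
  using assms unfolding strongly_convex_def by (meson atLeastAtMost_iff)

text \<open>Dividing the strong convexity inequality at \<open>mix d h y x\<close> by
  \<open>h\<close> bounds the difference quotient of F along the segment. As h tends to 0 from the
  right, the quotient tends to the directional derivative and the factor \<open>1 - h\<close> to
  1.\<close>

lemma strongly_convex_gradient_ineq:
  assumes sc: "strongly_convex d l F" and x: "x \<in> rvec d" and y: "y \<in> rvec d"
    and g: "has_gradient d F g x"
  shows "F x + (\<Sum>i<d. g i * (y i - x i)) + l / 2 * (vdist d y x)\<^sup>2 \<le> F y"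
proof -
  let ?V = "(vdist d y x)\<^sup>2"
  have "((\<lambda>s. F (mix d s y x)) has_real_derivative (\<Sum>i<d. g i * (y i - x i))) (at 0)"
    by (rule has_gradient_line_derivative) (simp add: mix_0 x g)
  then have lim: "((\<lambda>h. (F (mix d h y x) - F x) / h) \<longlongrightarrow> (\<Sum>i<d. g i * (y i - x i))) (at_right 0)"
    unfolding DERIV_def using x by (auto simp: mix_0 intro: filterlim_mono at_le)
  have "((\<lambda>h. F y - F x - l / 2 * (1 - h) * ?V) \<longlongrightarrow> F y - F x - l / 2 * (1 - 0) * ?V) (at_right 0)"
    by (intro tendsto_intros)
  moreover have "eventually (\<lambda>h. (F (mix d h y x) - F x) / h \<le> F y - F x - l / 2 * (1 - h) * ?V) (at_right (0::real))"
    using eventually_at_right_less[of 0] eventually_at_right_real[OF zero_less_one]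
  proof eventually_elim
    fix h :: real assume h: "0 < h" "h \<in> {0<..<1}"
    then have "F (mix d h y x) \<le> h * F y + (1 - h) * F x - l / 2 * h * (1 - h) * ?V"
      by (intro strongly_convexD[OF sc y x]) auto
    then have "F (mix d h y x) - F x \<le> (F y - F x - l / 2 * (1 - h) * ?V) * h"
      by (simp add: algebra_simps)
    then show "(F (mix d h y x) - F x) / h \<le> F y - F x - l / 2 * (1 - h) * ?V"
      using h by (simp add: pos_divide_le_eq)
  qed
  ultimately have "(\<Sum>i<d. g i * (y i - x i)) \<le> F y - F x - l / 2 * (1 - 0) * ?V"
    using lim by (intro tendsto_le[OF trivial_limit_at_right_real]) auto
  then show ?thesis by simp
qed

lemma sum_mult_le_vdist:
  "(\<Sum>i<d. (a i - b i) * (y i - x i)) \<le> vdist d a b * vdist d y x"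
proof -
  have "(\<Sum>i<d. (a i - b i) * (y i - x i)) \<le> (\<Sum>i<d. \<bar>a i - b i\<bar> * \<bar>y i - x i\<bar>)"
    by (intro sum_mono) (metis abs_ge_self abs_mult)
  also have "\<dots> \<le> vdist d a b * vdist d y x"
    unfolding vdist_def by (rule L2_set_mult_ineq)
  finally show ?thesis .
qed

lemma smooth_obtains_gradient:
  assumes "smooth d H F" "x \<in> rvec d"
  obtains g where "has_gradient d F g x"
  using assms unfolding smooth_def by meson

text \<open>Subtracting \<open>t * ?D + H / 2 * t^2 * ?V^2\<close> from F along the segment leaves a
  function that is nonincreasing on [0,1], by Cauchy-Schwarz and the Lipschitz gradient. Comparing
  its values at 0 and 1 gives the claim.\<close>

lemma smooth_descent_ineq:
  assumes sm: "smooth d H F" and x: "x \<in> rvec d" and y: "y \<in> rvec d"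
    and g: "has_gradient d F g x"
  shows "F y \<le> F x + (\<Sum>i<d. g i * (y i - x i)) + H / 2 * (vdist d y x)\<^sup>2"
proof -
  obtain G where "\<forall>x\<in>rvec d. has_gradient d F (G x) x"
    and "\<forall>x\<in>rvec d. \<forall>y\<in>rvec d. vdist d (G x) (G y) \<le> H * vdist d x y"
    using sm unfolding smooth_def by (elim exE conjE)
  note G = this(1)[rule_format] and L = this(2)[rule_format]
  let ?V = "vdist d y x" and ?D = "\<Sum>i<d. g i * (y i - x i)"
  let ?G = "\<lambda>t. \<Sum>i<d. G (mix d t y x) i * (y i - x i)"
  have deriv: "((\<lambda>s. F (mix d s y x)) has_real_derivative ?G t) (at t)" for t
    by (intro has_gradient_line_derivative G mix_rvec)
  have "((\<lambda>s. F (mix d s y x)) has_real_derivative ?D) (at 0)"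
    by (rule has_gradient_line_derivative) (simp add: mix_0 x g)
  \<comment> \<open>The given \<open>g\<close> need not be the field value \<open>G x\<close>;
    uniqueness of one-dimensional derivatives shows that both have the same inner product with the
    direction.\<close>
  with deriv[of 0] have G0: "?G 0 = ?D" by (rule DERIV_unique)
  have bound: "?G t - ?D \<le> H * t * ?V\<^sup>2" if "0 \<le> t" for t
  proof -
    have "?G t - ?D = (\<Sum>i<d. (G (mix d t y x) i - G (mix d 0 y x) i) * (y i - x i))"
      unfolding G0[symmetric] by (simp add: sum_subtractf[symmetric] algebra_simps)
    also have "\<dots> \<le> vdist d (G (mix d t y x)) (G (mix d 0 y x)) * ?V"
      by (rule sum_mult_le_vdist)
    also have "\<dots> \<le> (H * (\<bar>t - 0\<bar> * ?V)) * ?V"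
      using L[of "mix d t y x" "mix d 0 y x"] by (intro mult_right_mono) (auto simp: vdist_mix_mix)
    finally show ?thesis using that by (simp add: power2_eq_square mult_ac)
  qed
  have "F (mix d 1 y x) - 1 * ?D - H / 2 * 1\<^sup>2 * ?V\<^sup>2 \<le> F (mix d 0 y x) - 0 * ?D - H / 2 * 0\<^sup>2 * ?V\<^sup>2"
  proof (rule DERIV_nonpos_imp_nonincreasing[of 0 1 "\<lambda>t. F (mix d t y x) - t * ?D - H / 2 * t\<^sup>2 * ?V\<^sup>2"])
    fix t :: real assume t: "0 \<le> t" "t \<le> 1"
    have "((\<lambda>t. F (mix d t y x) - t * ?D - H / 2 * t\<^sup>2 * ?V\<^sup>2) has_real_derivative
        ?G t - ?D - H * t * ?V\<^sup>2) (at t)"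
      by (rule derivative_eq_intros deriv refl | simp)+
    moreover have "?G t - ?D - H * t * ?V\<^sup>2 \<le> 0" using bound[OF t(1)] by simp
    ultimately show "\<exists>z. ((\<lambda>t. F (mix d t y x) - t * ?D - H / 2 * t\<^sup>2 * ?V\<^sup>2) has_real_derivative z) (at t) \<and> z \<le> 0"
      by blast
  qed simp
  then show ?thesis using x y by (simp add: mix_0 mix_1)
qed

section \<open>Continuity and measurability of the objective\<close>

lemma smooth_continuous_restrict:
  assumes sm: "smooth d H F"
  shows "continuous_on UNIV (\<lambda>x. F (restrict x {..<d}))"
  unfolding continuous_on_def
proof
  fix x :: "nat \<Rightarrow> real"
  let ?r = "\<lambda>x :: nat \<Rightarrow> real. restrict x {..<d}"
  obtain g where g: "has_gradient d F g (?r x)"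
    by (rule smooth_obtains_gradient[OF sm, of "?r x"]) auto
  have comp: "((\<lambda>y. y i) \<longlongrightarrow> x i) (at x within UNIV)" for i
    using continuous_on_product_coordinates[of i, where 'b=real] unfolding continuous_on_def by blast
  have "((\<lambda>y. sqrt (\<Sum>i<d. (y i - x i)\<^sup>2)) \<longlongrightarrow> sqrt (\<Sum>i<d. (x i - x i)\<^sup>2)) (at x within UNIV)"
    by (intro tendsto_intros comp)
  then have V: "((\<lambda>y. vdist d (?r y) (?r x)) \<longlongrightarrow> 0) (at x within UNIV)"
    by (simp add: vdist_def L2_set_def)
  have "((\<lambda>y. \<Sum>i<d. g i * (y i - x i)) \<longlongrightarrow> (\<Sum>i<d. g i * (x i - x i))) (at x within UNIV)"
    by (intro tendsto_intros comp)
  then have S: "((\<lambda>y. \<Sum>i<d. g i * (?r y i - ?r x i)) \<longlongrightarrow> 0) (at x within UNIV)"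
    by simp
  obtain r where r: "r > 0" "\<And>y. y \<in> rvec d \<Longrightarrow> vdist d y (?r x) < r \<Longrightarrow>
      \<bar>F y - F (?r x) - (\<Sum>i<d. g i * (y i - ?r x i))\<bar> \<le> 1 * vdist d y (?r x)"
    using g unfolding has_gradient_def by (meson zero_less_one)
  \<comment> \<open>Near x the remainder is at most the distance by the gradient property with
    accuracy 1; the distance and the linear part both tend to 0, hence so does the increment of
    F.\<close>
  have "((\<lambda>y. F (?r y) - F (?r x) - (\<Sum>i<d. g i * (?r y i - ?r x i))) \<longlongrightarrow> 0) (at x within UNIV)"
  proof (rule Lim_null_comparison[OF _ V])
    show "eventually (\<lambda>y. norm (F (?r y) - F (?r x) - (\<Sum>i<d. g i * (?r y i - ?r x i)))
        \<le> vdist d (?r y) (?r x)) (at x within UNIV)"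
      using order_tendstoD(2)[OF V r(1)] by eventually_elim (use r(2)[of "?r _"] in simp)
  qed
  from tendsto_add[OF tendsto_add[OF this S] tendsto_const[of "F (?r x)"]]
  show "((\<lambda>x. F (?r x)) \<longlongrightarrow> F (?r x)) (at x within UNIV)" by simp
qed

text \<open>On total functions \<open>nat => real\<close> the product sigma-algebra is the Borel
  sigma-algebra of the product topology, so continuity yields measurability there. Extending by 0
  and restricting again carries it over to \<open>Rd d\<close>.\<close>

lemma smooth_measurable:
  assumes "smooth d H F"
  shows "F \<in> borel_measurable (Rd d)"
proof -
  have "(\<lambda>x. F (restrict x {..<d})) \<in> borel_measurable (PiM UNIV (\<lambda>_. borel))"
    using borel_measurable_continuous_onI[OF smooth_continuous_restrict[OF assms]]
    by (simp add: measurable_cong_sets[OF sets_PiM_equal_borel refl])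
  moreover have "(\<lambda>x i. if i < d then x i else 0) \<in> Rd d \<rightarrow>\<^sub>M PiM UNIV (\<lambda>_. borel :: real measure)"
  proof (rule measurable_PiM_single')
    show "(\<lambda>x. if i < d then x i else 0) \<in> borel_measurable (Rd d)" for i
      by (cases "i < d") auto
  qed auto
  ultimately have "(\<lambda>x. F (restrict (\<lambda>i. if i < d then x i else 0) {..<d})) \<in> borel_measurable (Rd d)"
    by (rule measurable_compose_rev)
  also have "?this \<longleftrightarrow> ?thesis"
    by (intro measurable_cong arg_cong[of _ _ F])
      (auto simp: space_PiM fun_eq_iff PiE_def extensional_def)
  finally show ?thesis .
qed

section \<open>Gaps, distances and the optimal value\<close>

context
  fixes d :: nat and l H :: real and F :: "(nat \<Rightarrow> real) \<Rightarrow> real"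
  assumes l: "0 < l" and sc: "strongly_convex d l F" and sm: "smooth d H F"
begin

text \<open>An infimum of reals is a lower bound only once the image is known to be bounded below.
  The strongly convex quadratic minorant at the origin, minimised in each coordinate by completing
  the square, provides such a bound.\<close>

lemma opt_val_lower:
  assumes x: "x \<in> rvec d"
  shows "opt_val d F \<le> F x"
proof -
  obtain g where g: "has_gradient d F g (origin d)"
    using smooth_obtains_gradient[OF sm origin_rvec] .
  have "F (origin d) - (\<Sum>i<d. (g i)\<^sup>2 / (2 * l)) \<le> F y" if y: "y \<in> rvec d" for y
  proof -
    have "- (\<Sum>i<d. (g i)\<^sup>2 / (2 * l)) \<le> (\<Sum>i<d. g i * (y i - origin d i) + l / 2 * (y i - origin d i)\<^sup>2)"
      unfolding sum_negf[symmetric]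
    proof (rule sum_mono)
      fix i
      have "0 \<le> (g i + l * (y i - origin d i))\<^sup>2 / (2 * l)" using l by simp
      also have "\<dots> = g i * (y i - origin d i) + l / 2 * (y i - origin d i)\<^sup>2 + (g i)\<^sup>2 / (2 * l)"
        using l by (simp add: field_simps power2_eq_square)
      finally show "- ((g i)\<^sup>2 / (2 * l)) \<le> g i * (y i - origin d i) + l / 2 * (y i - origin d i)\<^sup>2"
        by simp
    qed
    with strongly_convex_gradient_ineq[OF sc origin_rvec y g] show ?thesis
      by (simp add: vdist_square sum.distrib sum_distrib_left)
  qed
  then have "bdd_below (F ` rvec d)" by (intro bdd_belowI2)
  then show ?thesis unfolding opt_val_def using x by (intro cINF_lower)
qed

lemma opt_val_approx:
  assumes "0 < e"
  obtains u where "u \<in> rvec d" "F u < opt_val d F + e"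
proof -
  have "(INF x\<in>rvec d. F x) < opt_val d F + e" using assms by (simp add: opt_val_def)
  moreover have "bdd_below (F ` rvec d)" using opt_val_lower by (intro bdd_belowI2)
  moreover have "rvec d \<noteq> {}" using origin_rvec by blast
  ultimately show ?thesis using that by (subst (asm) cINF_less_iff) auto
qed

text \<open>Strong convexity at the midpoint of x and u, whose value is at least the optimal one.
  This replaces the usual distance to a minimiser.\<close>

lemma vdist_le_gaps:
  assumes x: "x \<in> rvec d" and u: "u \<in> rvec d"
  shows "(vdist d x u)\<^sup>2 \<le> 4 / l * ((F x - opt_val d F) + (F u - opt_val d F))"
proof -
  have "F (mix d (1/2) x u) \<le> 1/2 * F x + (1 - 1/2) * F u - l / 2 * (1/2) * (1 - 1/2) * (vdist d x u)\<^sup>2"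
    by (intro strongly_convexD[OF sc x u]) auto
  with opt_val_lower[OF mix_rvec, of "1/2" x u]
  have "l * (vdist d x u)\<^sup>2 \<le> 4 * ((F x - opt_val d F) + (F u - opt_val d F))" by simp
  then show ?thesis using l by (simp add: field_simps)
qed

text \<open>The quadratic lower and upper bounds around the origin are compared at the all-ones
  vector, which has squared length d and is nonzero because d is positive.\<close>

lemma strong_convexity_le_smoothness:
  assumes "0 < d"
  shows "l \<le> H"
proof -
  obtain g where g: "has_gradient d F g (origin d)"
    using smooth_obtains_gradient[OF sm origin_rvec] .
  define y :: "nat \<Rightarrow> real" where "y = (\<lambda>i\<in>{..<d}. 1)"
  have y: "y \<in> rvec d" by (simp add: y_def)
  have "(vdist d y (origin d))\<^sup>2 = d" by (simp add: vdist_square y_def origin_def)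
  with strongly_convex_gradient_ineq[OF sc origin_rvec y g] smooth_descent_ineq[OF sm origin_rvec y g]
  have "l / 2 * d \<le> H / 2 * d" by simp
  then show ?thesis using assms by simp
qed

end

subsection \<open>A stage of AC-SA\<close>

lemma space_Rd [simp]: "space (Rd d) = rvec d"
  by (simp add: space_PiM)

section \<open>Measurability of the updates; stages as Markov kernels\<close>

lemma measurable_mix [measurable (raw)]:
  assumes "f \<in> N \<rightarrow>\<^sub>M Rd d" "g \<in> N \<rightarrow>\<^sub>M Rd d"
  shows "(\<lambda>w. mix d a (f w) (g w)) \<in> N \<rightarrow>\<^sub>M Rd d"
  unfolding mix_def
proof (rule measurable_restrict)
  fix i assume i: "i \<in> {..<d}"
  note [measurable] = measurable_compose[OF assms(1) measurable_component_singleton[OF i]]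
    measurable_compose[OF assms(2) measurable_component_singleton[OF i]]
  show "(\<lambda>w. a * f w i + (1 - a) * g w i) \<in> borel_measurable N" by measurable
qed

lemma measurable_gradient_step [measurable (raw)]:
  assumes "f \<in> N \<rightarrow>\<^sub>M Rd d" "g \<in> N \<rightarrow>\<^sub>M Rd d"
  shows "(\<lambda>w. \<lambda>i\<in>{..<d}. f w i - c * g w i) \<in> N \<rightarrow>\<^sub>M Rd d"
proof (rule measurable_restrict)
  fix i assume i: "i \<in> {..<d}"
  note [measurable] = measurable_compose[OF assms(1) measurable_component_singleton[OF i]]
    measurable_compose[OF assms(2) measurable_component_singleton[OF i]]
  show "(\<lambda>w. f w i - c * g w i) \<in> borel_measurable N" by measurable
qed

lemma measurable_vdist [measurable (raw)]:
  assumes "f \<in> N \<rightarrow>\<^sub>M Rd d" "g \<in> N \<rightarrow>\<^sub>M Rd d"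
  shows "(\<lambda>w. vdist d (f w) (g w)) \<in> borel_measurable N"
proof -
  have "(\<lambda>w. f w i - g w i) \<in> borel_measurable N" if i: "i < d" for i
    using i assms[THEN measurable_compose[OF _ measurable_component_singleton[of i]]] by simp
  then have "(\<lambda>w. sqrt (\<Sum>i<d. (f w i - g w i)\<^sup>2)) \<in> borel_measurable N" by simp
  then show ?thesis by (simp add: vdist_def L2_set_def)
qed

text \<open>The recursion of \<open>acsa\<close> is split into a deterministic map of state and
  sampled gradient, and the kernel \<open>acsa_step\<close> that feeds it with a sample.
  Measurability and expectations can then be treated separately.\<close>

definition acsa_update ::
    "nat \<Rightarrow> real \<Rightarrow> real \<Rightarrow> (nat \<Rightarrow> real) \<times> (nat \<Rightarrow> real) \<Rightarrow> (nat \<Rightarrow> real) \<Rightarrow> (nat \<Rightarrow> real) \<times> (nat \<Rightarrow> real)" where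
  "acsa_update d b c p g =
     (let x' = (\<lambda>i\<in>{..<d}. fst p i - c * g i) in (x', mix d (1 / b) x' (snd p)))"

definition acsa_step :: "nat \<Rightarrow> vkernel \<Rightarrow> real \<Rightarrow> real \<Rightarrow> (nat \<Rightarrow> real) \<times> (nat \<Rightarrow> real) \<Rightarrow>
    ((nat \<Rightarrow> real) \<times> (nat \<Rightarrow> real)) measure" where
  "acsa_step d Q b c p =
     Q (mix d (1 / b) (fst p) (snd p)) \<bind> (\<lambda>g. return (Rd d \<Otimes>\<^sub>M Rd d) (acsa_update d b c p g))"

lemma acsa_Suc:
  "acsa d Q \<beta> \<gamma> x0 (Suc t) = acsa d Q \<beta> \<gamma> x0 t \<bind> acsa_step d Q (\<beta> t) (\<gamma> t)"
  by (simp add: acsa_step_def[abs_def] acsa_update_def Let_def case_prod_unfold)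

lemma measurable_acsa_update [measurable]:
  "(\<lambda>(p, g). acsa_update d b c p g) \<in> (Rd d \<Otimes>\<^sub>M Rd d) \<Otimes>\<^sub>M Rd d \<rightarrow>\<^sub>M Rd d \<Otimes>\<^sub>M Rd d"
  unfolding acsa_update_def Let_def case_prod_unfold by measurable

lemma measurable_acsa_update' [measurable]:
  assumes "p \<in> space (Rd d \<Otimes>\<^sub>M Rd d)"
  shows "acsa_update d b c p \<in> Rd d \<rightarrow>\<^sub>M Rd d \<Otimes>\<^sub>M Rd d"
  using measurable_compose[OF measurable_Pair1'[OF assms] measurable_acsa_update] by simp

locale kernel =
  fixes d :: nat and Q :: vkernel
  assumes Q [measurable]: "Q \<in> Rd d \<rightarrow>\<^sub>M prob_algebra (Rd d)"
begin

lemma Q_sets [simp]: "x \<in> rvec d \<Longrightarrow> sets (Q x) = sets (Rd d)"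
  and Q_prob: "x \<in> rvec d \<Longrightarrow> prob_space (Q x)"
  using measurable_space[OF Q, of x] by (simp_all add: space_prob_algebra)

lemma measurable_acsa_step [measurable]:
  "acsa_step d Q b c \<in> Rd d \<Otimes>\<^sub>M Rd d \<rightarrow>\<^sub>M prob_algebra (Rd d \<Otimes>\<^sub>M Rd d)"
  unfolding acsa_step_def
proof (rule measurable_bind_prob_space2)
  show "(\<lambda>p. Q (mix d (1 / b) (fst p) (snd p))) \<in> Rd d \<Otimes>\<^sub>M Rd d \<rightarrow>\<^sub>M prob_algebra (Rd d)"
    by measurable
  show "(\<lambda>(p, g). return (Rd d \<Otimes>\<^sub>M Rd d) (acsa_update d b c p g))
      \<in> (Rd d \<Otimes>\<^sub>M Rd d) \<Otimes>\<^sub>M Rd d \<rightarrow>\<^sub>M prob_algebra (Rd d \<Otimes>\<^sub>M Rd d)"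
    using measurable_compose[OF measurable_acsa_update measurable_return_prob_space]
    by (simp add: case_prod_unfold)
qed

text \<open>Binding with \<open>return\<close> is a push-forward, so this is a change of variables.
  Nonnegative integrals avoid tracking integrability along the iteration; it is recovered at the end
  from the finite bound.\<close>

lemma nn_integral_acsa_step:
  assumes x: "x \<in> rvec d" and ag: "ag \<in> rvec d"
    and f: "f \<in> borel_measurable (Rd d \<Otimes>\<^sub>M Rd d)"
  shows "(\<integral>\<^sup>+p. f p \<partial>acsa_step d Q b c (x, ag)) =
    (\<integral>\<^sup>+g. f (acsa_update d b c (x, ag) g) \<partial>Q (mix d (1 / b) x ag))"
proof -
  let ?Q = "Q (mix d (1 / b) x ag)"
  have p: "(x, ag) \<in> space (Rd d \<Otimes>\<^sub>M Rd d)" using x ag by (simp add: space_pair_measure)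
  have u: "acsa_update d b c (x, ag) \<in> ?Q \<rightarrow>\<^sub>M Rd d \<Otimes>\<^sub>M Rd d"
    using measurable_acsa_update'[OF p] by (simp cong: measurable_cong_sets)
  interpret prob_space ?Q by (rule Q_prob) simp
  have "acsa_step d Q b c (x, ag) = distr ?Q (Rd d \<Otimes>\<^sub>M Rd d) (acsa_update d b c (x, ag))"
    unfolding acsa_step_def using bind_return_distr'[OF not_empty u] by simp
  then show ?thesis using f by (simp add: nn_integral_distr[OF u])
qed

lemma measurable_acsa:
  "(\<lambda>x0. acsa d Q \<beta> \<gamma> x0 t) \<in> Rd d \<rightarrow>\<^sub>M prob_algebra (Rd d \<Otimes>\<^sub>M Rd d)"
proof (induction t)
  case 0
  have "(\<lambda>x0. (x0, x0)) \<in> Rd d \<rightarrow>\<^sub>M Rd d \<Otimes>\<^sub>M Rd d" by measurable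
  from measurable_compose[OF this measurable_return_prob_space] show ?case by simp
next
  case (Suc t)
  show ?case unfolding acsa_Suc
    by (rule measurable_bind_prob_space[OF Suc measurable_acsa_step])
qed

lemma acsa_sets [simp]: "x \<in> rvec d \<Longrightarrow> sets (acsa d Q \<beta> \<gamma> x t) = sets (Rd d \<Otimes>\<^sub>M Rd d)"
  and acsa_prob: "x \<in> rvec d \<Longrightarrow> prob_space (acsa d Q \<beta> \<gamma> x t)"
  using measurable_space[OF measurable_acsa, of x] by (simp_all add: space_prob_algebra)

lemma measurable_multi_acsa:
  "multi_acsa d Q ss \<in> Rd d \<rightarrow>\<^sub>M prob_algebra (Rd d)"
proof (induction ss)
  case Nil
  then show ?case using measurable_return_prob_space[of "Rd d"] by (simp cong: measurable_cong)
next
  case (Cons s ss)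
  obtain T \<beta> \<gamma> where s: "s = (T, \<beta>, \<gamma>)" by (cases s)
  have "(\<lambda>x. distr (acsa d Q \<beta> \<gamma> x T) (Rd d) snd) \<in> Rd d \<rightarrow>\<^sub>M prob_algebra (Rd d)"
    by (rule measurable_compose[OF measurable_acsa measurable_distr_prob_space]) simp
  from measurable_bind_prob_space[OF this Cons] show ?case by (simp add: s)
qed

lemma multi_acsa_sets [simp]: "x \<in> rvec d \<Longrightarrow> sets (multi_acsa d Q ss x) = sets (Rd d)"
  and multi_acsa_prob: "x \<in> rvec d \<Longrightarrow> prob_space (multi_acsa d Q ss x)"
  using measurable_space[OF measurable_multi_acsa, of x] by (simp_all add: space_prob_algebra)

lemma multi_acsa_single:
  assumes "x \<in> rvec d"
  shows "multi_acsa d Q [(T, \<beta>, \<gamma>)] x = distr (acsa d Q \<beta> \<gamma> x T) (Rd d) snd"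
proof -
  have "multi_acsa d Q [(T, \<beta>, \<gamma>)] x = distr (acsa d Q \<beta> \<gamma> x T) (Rd d) snd \<bind> return (Rd d)"
    by (simp add: multi_acsa.simps(1)[abs_def])
  then show ?thesis by (simp add: bind_return'')
qed

text \<open>Associativity of bind: the later stages depend on the earlier ones only through the
  point at which they are restarted.\<close>

lemma multi_acsa_append:
  assumes "x \<in> rvec d"
  shows "multi_acsa d Q (ss @ ss') x = multi_acsa d Q ss x \<bind> multi_acsa d Q ss'"
  using assms
proof (induction ss arbitrary: x)
  case Nil
  then show ?case
    using bind_return[of "multi_acsa d Q ss'" "Rd d" "Rd d" x]
      measurable_prob_algebraD[OF measurable_multi_acsa, of ss'] by simp
next
  case (Cons s ss)
  obtain T \<beta> \<gamma> where s: "s = (T, \<beta>, \<gamma>)" by (cases s)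
  let ?M = "distr (acsa d Q \<beta> \<gamma> x T) (Rd d) snd"
  have m: "multi_acsa d Q ss \<in> ?M \<rightarrow>\<^sub>M subprob_algebra (Rd d)" for ss
    using measurable_prob_algebraD[OF measurable_multi_acsa] by simp
  have "multi_acsa d Q ((s # ss) @ ss') x = ?M \<bind> multi_acsa d Q (ss @ ss')"
    by (simp add: s)
  also have "\<dots> = ?M \<bind> (\<lambda>y. multi_acsa d Q ss y \<bind> multi_acsa d Q ss')"
    by (rule bind_cong) (simp_all add: Cons.IH)
  also have "\<dots> = (?M \<bind> multi_acsa d Q ss) \<bind> multi_acsa d Q ss'"
    using m[of ss] measurable_prob_algebraD[OF measurable_multi_acsa, of ss'] by (simp add: bind_assoc)
  finally show ?case by (simp add: s)
qed

end

section \<open>The potential argument for one stage\<close>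

locale noisy_problem =
  fixes d :: nat and F :: "(nat \<Rightarrow> real) \<Rightarrow> real" and l H s :: real and Q :: vkernel
  assumes l: "0 < l" and sc: "strongly_convex d l F" and sm: "smooth d H F"
    and noise: "grad_oracle d F s Q"

sublocale noisy_problem \<subseteq> kernel d Q
  using noise by unfold_locales (simp add: grad_oracle_def)

context noisy_problem
begin

abbreviation gap :: "(nat \<Rightarrow> real) \<Rightarrow> real" where
  "gap x \<equiv> F x - opt_val d F"

lemma gap_nonneg: "x \<in> rvec d \<Longrightarrow> 0 \<le> gap x"
  using opt_val_lower[OF l sc sm] by simp

lemma measurable_F [measurable]: "F \<in> borel_measurable (Rd d)"
  by (rule smooth_measurable[OF sm])

text \<open>Mean and variance in the form needed below: expectations of linear functionals, and the
  second moment, which is the variance plus the squared norm of the mean.\<close>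

lemma oracle_moments:
  assumes x: "x \<in> rvec d"
  obtains g where "has_gradient d F g x"
    "\<forall>v. integrable (Q x) (\<lambda>z. \<Sum>i<d. z i * v i)"
    "\<forall>v. (LINT z|Q x. (\<Sum>i<d. z i * v i)) = (\<Sum>i<d. g i * v i)"
    "integrable (Q x) (\<lambda>z. \<Sum>i<d. (z i)\<^sup>2)"
    "(LINT z|Q x. (\<Sum>i<d. (z i)\<^sup>2)) \<le> (\<Sum>i<d. (g i)\<^sup>2) + s\<^sup>2"
proof -
  have "\<forall>x\<in>rvec d. \<exists>g. has_gradient d F g x \<and>
      (\<forall>i<d. integrable (Q x) (\<lambda>z. z i) \<and> (LINT z|Q x. z i) = g i) \<and>
      integrable (Q x) (\<lambda>z. (vdist d z g)\<^sup>2) \<and> (LINT z|Q x. (vdist d z g)\<^sup>2) \<le> s\<^sup>2"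
    using noise[unfolded grad_oracle_def] by (elim conjE)
  from bspec[OF this x] obtain g where g: "has_gradient d F g x"
    and 1: "\<And>i. i < d \<Longrightarrow> integrable (Q x) (\<lambda>z. z i)" "\<And>i. i < d \<Longrightarrow> (LINT z|Q x. z i) = g i"
    and 2: "integrable (Q x) (\<lambda>z. (vdist d z g)\<^sup>2)" "(LINT z|Q x. (vdist d z g)\<^sup>2) \<le> s\<^sup>2"
    by meson
  interpret prob_space "Q x" by (rule Q_prob[OF x])
  have int: "integrable (Q x) (\<lambda>z. \<Sum>i<d. z i * v i)" for v
    using 1 by (intro Bochner_Integration.integrable_sum) simp
  have lin: "(LINT z|Q x. (\<Sum>i<d. z i * v i)) = (\<Sum>i<d. g i * v i)" for v
    using 1 by simp
  have eq: "(\<lambda>z. \<Sum>i<d. (z i)\<^sup>2) =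
      (\<lambda>z. (vdist d z g)\<^sup>2 + 2 * (\<Sum>i<d. z i * g i) - (\<Sum>i<d. (g i)\<^sup>2))"
    by (rule ext) (simp add: vdist_square power2_diff sum.distrib sum_subtractf sum_distrib_left algebra_simps)
  show thesis
  proof (rule that[OF g allI[OF int] allI[OF lin]])
    show "integrable (Q x) (\<lambda>z. \<Sum>i<d. (z i)\<^sup>2)"
      by (subst eq) (use 2 int in simp)
    have "(LINT z|Q x. (\<Sum>i<d. (z i)\<^sup>2)) =
        (LINT z|Q x. (vdist d z g)\<^sup>2) + 2 * (\<Sum>i<d. g i * g i) - (\<Sum>i<d. (g i)\<^sup>2)"
      by (subst eq) (use 2 int lin[of g] in \<open>simp add: prob_space\<close>)
    then show "(LINT z|Q x. (\<Sum>i<d. (z i)\<^sup>2)) \<le> (\<Sum>i<d. (g i)\<^sup>2) + s\<^sup>2"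
      using 2 by (simp add: power2_eq_square)
  qed
qed

lemma measurable_potential:
  assumes "u \<in> rvec d"
  shows "(\<lambda>p. ennreal (A * gap (snd p) + k * (vdist d (fst p) u)\<^sup>2)) \<in> borel_measurable (Rd d \<Otimes>\<^sub>M Rd d)"
proof -
  have [measurable]: "(\<lambda>p. u) \<in> Rd d \<Otimes>\<^sub>M Rd d \<rightarrow>\<^sub>M Rd d"
    using assms by (intro measurable_const) simp
  show ?thesis by measurable
qed

text \<open>
  With \<open>a = 1 / b\<close>, the weights \<open>A\<close> and \<open>k\<close> are balanced by \<open>A * a = 2 * k * c\<close> so that the inner products
  of the gradient with \<open>x - u\<close> cancel, and \<open>H * a * c \<le> 1\<close> lets the squared gradient norm drop out.
\<close>

lemma acsa_step_potential:
  assumes x: "x \<in> rvec d" and ag: "ag \<in> rvec d" and u: "u \<in> rvec d"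
    and b: "1 \<le> b" and c: "0 \<le> c" and A: "0 \<le> A" and k: "0 \<le> k"
    and H: "H * (1 / b) * c \<le> 1" and bal: "A * (1 / b) = 2 * k * c"
  shows "(\<integral>\<^sup>+p. ennreal (A * gap (snd p) + k * (vdist d (fst p) u)\<^sup>2) \<partial>acsa_step d Q b c (x, ag))
    \<le> ennreal (A * (1 - 1 / b) * gap ag + k * (vdist d x u)\<^sup>2
        + A * (1 / b) * gap u + A * (1 / b) * c * s\<^sup>2)"
proof -
  define a where "a = 1 / b"
  have a: "0 \<le> a" "a \<le> 1" using b by (simp_all add: a_def)
  define md where "md = mix d a x ag"
  have md: "md \<in> rvec d" by (simp add: md_def)
  obtain g where g: "has_gradient d F g md"
    and int_lin: "\<forall>v. integrable (Q md) (\<lambda>z. \<Sum>i<d. z i * v i)"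
      "\<forall>v. (LINT z|Q md. (\<Sum>i<d. z i * v i)) = (\<Sum>i<d. g i * v i)"
    and int2: "integrable (Q md) (\<lambda>z. \<Sum>i<d. (z i)\<^sup>2)"
    and sq: "(LINT z|Q md. (\<Sum>i<d. (z i)\<^sup>2)) \<le> (\<Sum>i<d. (g i)\<^sup>2) + s\<^sup>2"
    by (rule oracle_moments[OF md]) (rule that)
  note int = int_lin(1)[rule_format] and lin = int_lin(2)[rule_format]
  interpret prob_space "Q md" by (rule Q_prob[OF md])
  \<comment> \<open>Both \<open>md\<close> and the new aggregate point mix in the same
    \<open>ag\<close> with the same weight, so they differ by \<open>- a * c * z\<close>; this is
    what makes the descent inequality at \<open>md\<close> usable.\<close>
  define upd where "upd z = acsa_update d b c (x, ag) z" for z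
  have upd: "upd z = ((\<lambda>i\<in>{..<d}. x i - c * z i), mix d a (\<lambda>i\<in>{..<d}. x i - c * z i) ag)" for z
    by (simp add: upd_def acsa_update_def a_def Let_def)
  have fst_upd: "fst (upd z) i = x i - c * z i"
    and snd_upd: "snd (upd z) i = md i - a * c * z i" if "i < d" for z i
    using that by (simp_all add: upd md_def mix_def algebra_simps)
  have upd_rvec: "snd (upd z) \<in> rvec d" for z by (simp add: upd)
  define N where "N z = (\<Sum>i<d. (z i)\<^sup>2)" for z :: "nat \<Rightarrow> real"
  define I where "I z v = (\<Sum>i<d. z i * v i)" for z v :: "nat \<Rightarrow> real"
  \<comment> \<open>A majorant of the new potential, from the descent inequality for the gap and
    exact expansion for the distance. It is linear in z apart from the squared norm, so its
    expectation needs only the known moments.\<close>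
  define q where "q z = A * (gap md - a * c * I z g + H / 2 * (a * c)\<^sup>2 * N z)
    + k * ((vdist d x u)\<^sup>2 - 2 * c * I z (\<lambda>i. x i - u i) + c\<^sup>2 * N z)" for z
  have pointwise: "A * gap (snd (upd z)) + k * (vdist d (fst (upd z)) u)\<^sup>2 \<le> q z" for z
  proof -
    have "(\<Sum>i<d. g i * (snd (upd z) i - md i)) = - (a * c * I z g)"
      unfolding I_def sum_distrib_left sum_negf[symmetric]
      by (intro sum.cong) (simp_all add: snd_upd)
    moreover have "(vdist d (snd (upd z)) md)\<^sup>2 = (a * c)\<^sup>2 * N z"
      unfolding vdist_square N_def sum_distrib_left
      by (intro sum.cong) (simp_all add: snd_upd power_mult_distrib)
    ultimately have "gap (snd (upd z)) \<le> gap md - a * c * I z g + H / 2 * (a * c)\<^sup>2 * N z"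
      using smooth_descent_ineq[OF sm md upd_rvec g, of z] by simp
    moreover have "(vdist d (fst (upd z)) u)\<^sup>2
        = (vdist d x u)\<^sup>2 - 2 * c * I z (\<lambda>i. x i - u i) + c\<^sup>2 * N z"
      unfolding vdist_square N_def I_def sum_distrib_left sum_subtractf[symmetric] sum.distrib[symmetric]
      by (intro sum.cong) (simp_all add: fst_upd power2_eq_square algebra_simps)
    ultimately show ?thesis
      unfolding q_def using A k by (intro add_mono mult_left_mono) auto
  qed
  have q_int: "integrable (Q md) q"
    unfolding q_def I_def N_def
    by (intro Bochner_Integration.integrable_add Bochner_Integration.integrable_diff
        integrable_mult_right integrable_const int int2)
  have q_nonneg: "0 \<le> q z" for z
    by (rule order_trans[OF _ pointwise]) (use A k gap_nonneg[OF upd_rvec] in auto)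
  have "(LINT z|Q md. q z) = A * (gap md - a * c * I g g + H / 2 * (a * c)\<^sup>2 * (LINT z|Q md. N z))
      + k * ((vdist d x u)\<^sup>2 - 2 * c * I g (\<lambda>i. x i - u i) + c\<^sup>2 * (LINT z|Q md. N z))"
    unfolding q_def I_def N_def using int int2 by (simp add: lin prob_space)
  \<comment> \<open>Balancing gives \<open>k * c^2 = A * a * c / 2\<close>, so the two terms with
    the squared norm merge, with a factor \<open>(H * a * c + 1) / 2\<close> that is at most
    1.\<close>
  also have "\<dots> = A * (gap md - a * c * I g g) + k * ((vdist d x u)\<^sup>2 - 2 * c * I g (\<lambda>i. x i - u i))
      + A * a * c * ((H * a * c + 1) / 2) * (LINT z|Q md. N z)"
    using bal[folded a_def] by (simp add: power2_eq_square algebra_simps)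
  also have "\<dots> \<le> A * (gap md - a * c * I g g) + k * ((vdist d x u)\<^sup>2 - 2 * c * I g (\<lambda>i. x i - u i))
      + A * a * c * (I g g + s\<^sup>2)"
  proof -
    have N: "0 \<le> (LINT z|Q md. N z)" "(LINT z|Q md. N z) \<le> I g g + s\<^sup>2"
      using sq by (auto simp: N_def I_def power2_eq_square sum_nonneg intro!: integral_nonneg)
    have "(H * a * c + 1) / 2 * (LINT z|Q md. N z) \<le> 1 * (LINT z|Q md. N z)"
      using H N by (intro mult_right_mono) (auto simp: a_def)
    then have "A * a * c * ((H * a * c + 1) / 2 * (LINT z|Q md. N z)) \<le> A * a * c * (I g g + s\<^sup>2)"
      using N A a c by (intro mult_left_mono) auto
    then show ?thesis by (simp add: mult.assoc)
  qed
  \<comment> \<open>The two occurrences of \<open>A * a * c * I g g\<close> cancel, and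
    \<open>2 * k * c\<close> becomes \<open>A * a\<close>.\<close>
  also have "\<dots> = A * gap md - A * a * I g (\<lambda>i. x i - u i) + k * (vdist d x u)\<^sup>2 + A * a * c * s\<^sup>2"
    using bal[folded a_def] by (simp add: algebra_simps)
  \<comment> \<open>Convexity bounds F from below at \<open>ag\<close> and \<open>u\<close> by the
    linearisation at \<open>md\<close>. With weights \<open>1 - a\<close> and \<open>a\<close> the
    displacements sum to \<open>- a * (x - u)\<close>, since \<open>md\<close> mixes
    \<open>x\<close> and \<open>ag\<close>.\<close>
  also have "\<dots> \<le> A * ((1 - a) * gap ag + a * gap u) + k * (vdist d x u)\<^sup>2 + A * a * c * s\<^sup>2"
  proof -
    have grad: "F md + I g (\<lambda>i. y i - md i) \<le> F y" if "y \<in> rvec d" for y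
      using strongly_convex_gradient_ineq[OF sc md that g] l unfolding I_def
      by (smt (verit) divide_nonneg_nonneg mult_nonneg_nonneg zero_le_power2)
    have "(1 - a) * (F md + I g (\<lambda>i. ag i - md i)) + a * (F md + I g (\<lambda>i. u i - md i))
        \<le> (1 - a) * F ag + a * F u"
      using a grad[OF ag] grad[OF u] by (intro add_mono mult_left_mono) auto
    moreover have "(1 - a) * I g (\<lambda>i. ag i - md i) + a * I g (\<lambda>i. u i - md i) = - (a * I g (\<lambda>i. x i - u i))"
      unfolding I_def sum_distrib_left sum.distrib[symmetric] sum_negf[symmetric]
      by (intro sum.cong) (simp_all add: md_def mix_def algebra_simps)
    ultimately have "gap md - a * I g (\<lambda>i. x i - u i) \<le> (1 - a) * gap ag + a * gap u"
      by (simp add: algebra_simps)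
    from mult_left_mono[OF this A] show ?thesis by (simp add: algebra_simps)
  qed
  finally have bound: "(LINT z|Q md. q z)
      \<le> A * (1 - a) * gap ag + k * (vdist d x u)\<^sup>2 + A * a * gap u + A * a * c * s\<^sup>2"
    by (simp add: algebra_simps)
  have "(\<integral>\<^sup>+p. ennreal (A * gap (snd p) + k * (vdist d (fst p) u)\<^sup>2) \<partial>acsa_step d Q b c (x, ag))
      = (\<integral>\<^sup>+z. ennreal (A * gap (snd (upd z)) + k * (vdist d (fst (upd z)) u)\<^sup>2) \<partial>Q md)"
    unfolding upd_def md_def a_def
    by (intro nn_integral_acsa_step x ag measurable_potential u)
  also have "\<dots> \<le> (\<integral>\<^sup>+z. ennreal (q z) \<partial>Q md)"
    by (intro nn_integral_mono ennreal_leI pointwise)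
  also have "\<dots> = ennreal (LINT z|Q md. q z)"
    using q_int q_nonneg by (intro nn_integral_eq_integral) auto
  also note ennreal_leI[OF bound]
  finally show ?thesis unfolding a_def .
qed

text \<open>The one-step bound is used with \<open>A = (t + 1) * (t + 2)\<close> and
  \<open>k = 2 / \<gamma>\<close>. Then \<open>A * (1 - 1 / b) = t * (t + 1)\<close> is the previous
  weight, so the bounds telescope. At t = 0 the weight of the gap vanishes, so only the initial
  distance enters.\<close>

lemma acsa_potential:
  assumes x0: "x0 \<in> rvec d" and u: "u \<in> rvec d" and \<gamma>: "0 < \<gamma>" and H: "H * \<gamma> \<le> 1"
  shows "(\<integral>\<^sup>+p. ennreal (real t * (real t + 1) * gap (snd p) + 2 / \<gamma> * (vdist d (fst p) u)\<^sup>2)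
      \<partial>acsa d Q (\<lambda>t. (real t + 2) / 2) (\<lambda>t. \<gamma> * (real t + 1) / 2) x0 t)
    \<le> ennreal (2 / \<gamma> * (vdist d x0 u)\<^sup>2 + real t * (real t + 1) * gap u
        + \<gamma> * s\<^sup>2 * ((real t)\<^sup>2 * (real t + 1) / 2))"
proof (induction t)
  case 0
  show ?case
    using x0 u \<gamma> by (subst acsa.simps, subst nn_integral_return) (auto simp: space_pair_measure)
next
  case (Suc t)
  let ?a = "acsa d Q (\<lambda>t. (real t + 2) / 2) (\<lambda>t. \<gamma> * (real t + 1) / 2) x0 t"
  let ?\<Phi> = "\<lambda>t p. real t * (real t + 1) * gap (snd p) + 2 / \<gamma> * (vdist d (fst p) u)\<^sup>2"
  let ?r = "2 * (real t + 1) * gap u + \<gamma> * s\<^sup>2 * (real t + 1)\<^sup>2"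
  interpret prob_space ?a by (rule acsa_prob[OF x0])
  have [simp]: "space ?a = rvec d \<times> rvec d"
    using sets_eq_imp_space_eq[OF acsa_sets[OF x0]] by (simp add: space_pair_measure)
  have mass: "emeasure ?a (rvec d \<times> rvec d) = 1" using emeasure_space_1 by simp
  have r: "0 \<le> ?r" using gap_nonneg[OF u] \<gamma> by simp
  have meas: "(\<lambda>p. ennreal (?\<Phi> t p)) \<in> borel_measurable (Rd d \<Otimes>\<^sub>M Rd d)" for t
    by (rule measurable_potential[OF u])
  have "(\<integral>\<^sup>+p. ennreal (?\<Phi> (Suc t) p) \<partial>acsa_step d Q ((real t + 2) / 2) (\<gamma> * (real t + 1) / 2) p')
      \<le> ennreal (?\<Phi> t p') + ennreal ?r" if p': "p' \<in> space ?a" for p'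
  proof -
    obtain x ag where p'_eq: "p' = (x, ag)" and x: "x \<in> rvec d" and ag: "ag \<in> rvec d"
      using p' by (cases p') auto
    have A: "(real t + 1) * (real t + 2) * (1 / ((real t + 2) / 2)) = 2 * (real t + 1)" by simp
    have "H * (1 / ((real t + 2) / 2)) * (\<gamma> * (real t + 1) / 2) = (H * \<gamma>) * ((real t + 1) / (real t + 2))"
      by (simp add: field_simps)
    also have "\<dots> \<le> 1 * ((real t + 1) / (real t + 2))" using H by (intro mult_right_mono) auto
    also have "\<dots> \<le> 1" by simp
    finally have H': "H * (1 / ((real t + 2) / 2)) * (\<gamma> * (real t + 1) / 2) \<le> 1" .
    have "(\<integral>\<^sup>+p. ennreal ((real t + 1) * (real t + 2) * gap (snd p) + 2 / \<gamma> * (vdist d (fst p) u)\<^sup>2)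
        \<partial>acsa_step d Q ((real t + 2) / 2) (\<gamma> * (real t + 1) / 2) (x, ag))
      \<le> ennreal ((real t + 1) * (real t + 2) * (1 - 1 / ((real t + 2) / 2)) * gap ag
        + 2 / \<gamma> * (vdist d x u)\<^sup>2
        + (real t + 1) * (real t + 2) * (1 / ((real t + 2) / 2)) * gap u
        + (real t + 1) * (real t + 2) * (1 / ((real t + 2) / 2)) * (\<gamma> * (real t + 1) / 2) * s\<^sup>2)"
      using \<gamma> by (intro acsa_step_potential x ag u H') (auto simp: A)
    also have "(real t + 1) * (real t + 2) * (1 - 1 / ((real t + 2) / 2)) = real t * (real t + 1)"
      by (simp add: field_simps)
    also have "real t * (real t + 1) * gap ag + 2 / \<gamma> * (vdist d x u)\<^sup>2
        + (real t + 1) * (real t + 2) * (1 / ((real t + 2) / 2)) * gap u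
        + (real t + 1) * (real t + 2) * (1 / ((real t + 2) / 2)) * (\<gamma> * (real t + 1) / 2) * s\<^sup>2
      = ?\<Phi> t p' + ?r"
      unfolding A by (simp add: p'_eq power2_eq_square algebra_simps)
    finally show ?thesis
      using r gap_nonneg[OF ag] \<gamma> by (subst ennreal_plus[symmetric]) (auto simp: p'_eq add_ac mult_ac)
  qed
  then have "(\<integral>\<^sup>+p. ennreal (?\<Phi> (Suc t) p) \<partial>acsa d Q (\<lambda>t. (real t + 2) / 2) (\<lambda>t. \<gamma> * (real t + 1) / 2) x0 (Suc t))
      \<le> (\<integral>\<^sup>+p. (ennreal (?\<Phi> t p) + ennreal ?r) \<partial>?a)"
    unfolding acsa_Suc
    by (subst nn_integral_bind[OF meas, where M = ?a])
      (use measurable_prob_algebraD[OF measurable_acsa_step] in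
        \<open>auto simp: x0 cong: measurable_cong_sets intro!: nn_integral_mono\<close>)
  also have "\<dots> = (\<integral>\<^sup>+p. ennreal (?\<Phi> t p) \<partial>?a) + ennreal ?r"
    using meas[of t] by (subst nn_integral_add) (auto simp: mass x0 cong: measurable_cong_sets)
  also have "\<dots> \<le> ennreal (2 / \<gamma> * (vdist d x0 u)\<^sup>2 + real t * (real t + 1) * gap u
        + \<gamma> * s\<^sup>2 * ((real t)\<^sup>2 * (real t + 1) / 2)) + ennreal ?r"
    by (intro add_right_mono Suc.IH)
  also have "\<dots> = ennreal (2 / \<gamma> * (vdist d x0 u)\<^sup>2 + real t * (real t + 1) * gap u
        + \<gamma> * s\<^sup>2 * ((real t)\<^sup>2 * (real t + 1) / 2) + ?r)"
    using r gap_nonneg[OF u] \<gamma> by (subst ennreal_plus) auto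
  also have "\<dots> \<le> ennreal (2 / \<gamma> * (vdist d x0 u)\<^sup>2 + real (Suc t) * (real (Suc t) + 1) * gap u
        + \<gamma> * s\<^sup>2 * ((real (Suc t))\<^sup>2 * (real (Suc t) + 1) / 2))"
  \<comment> \<open>The sum of \<open>(j + 1)^2\<close> over \<open>j < t\<close> is bounded by
    \<open>t^2 * (t + 1) / 2\<close>; this is the inductive step of that bound.\<close>
  proof (rule ennreal_leI)
    have "(real t)\<^sup>2 * (real t + 1) / 2 + (real t + 1)\<^sup>2 \<le> (real (Suc t))\<^sup>2 * (real (Suc t) + 1) / 2"
      by (simp add: power2_eq_square algebra_simps)
    from mult_left_mono[OF this, of "\<gamma> * s\<^sup>2"] \<gamma>
    show "2 / \<gamma> * (vdist d x0 u)\<^sup>2 + real t * (real t + 1) * gap u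
        + \<gamma> * s\<^sup>2 * ((real t)\<^sup>2 * (real t + 1) / 2) + ?r
      \<le> 2 / \<gamma> * (vdist d x0 u)\<^sup>2 + real (Suc t) * (real (Suc t) + 1) * gap u
        + \<gamma> * s\<^sup>2 * ((real (Suc t))\<^sup>2 * (real (Suc t) + 1) / 2)"
      by (simp add: algebra_simps)
  qed
  finally show ?case .
qed

text \<open>The potential bound is divided by \<open>T * (T + 1)\<close>. The choice of
  \<open>\<gamma>\<close> turns the distance term into at most \<open>l / 16\<close> times the
  squared distance, hence a quarter of the gaps, and the noise term into
  \<open>\<gamma> * s^2 * T / 2 = 16 * s^2 / (l * T)\<close>. The length condition gives
  \<open>36 * H \<le> l * T^2\<close> and so \<open>H * \<gamma> \<le> 1\<close>.\<close>

lemma stage_contraction: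
  assumes H: "0 < H" and T: "1 \<le> T" "6 * sqrt (H / l) \<le> real T" and x0: "x0 \<in> rvec d"
  defines "\<gamma> \<equiv> 32 / (l * (real T)\<^sup>2)"
  shows "(\<integral>\<^sup>+x. ennreal (gap x)
      \<partial>multi_acsa d Q [(T, \<lambda>t. (real t + 2) / 2, \<lambda>t. \<gamma> * (real t + 1) / 2)] x0)
    \<le> ennreal (1 / 4 * gap x0 + 16 * (s\<^sup>2 / (l * real T)))"
proof (rule ennreal_le_epsilon)
  fix e :: real assume e: "0 < e"
  let ?a = "acsa d Q (\<lambda>t. (real t + 2) / 2) (\<lambda>t. \<gamma> * (real t + 1) / 2) x0 T"
  define A where "A = real T * (real T + 1)"
  have T0: "0 < real T" and A: "0 < A" using T by (simp_all add: A_def)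
  have \<gamma>: "0 < \<gamma>" using l T0 by (simp add: \<gamma>_def)
  have "36 * (H / l) = (6 * sqrt (H / l))\<^sup>2" using H l by (simp add: power_mult_distrib)
  also have "\<dots> \<le> (real T)\<^sup>2" using T H l by (intro power_mono) auto
  finally have "32 * H \<le> l * (real T)\<^sup>2" using H l by (simp add: field_simps)
  then have H\<gamma>: "H * \<gamma> \<le> 1" using l T0 by (simp add: \<gamma>_def pos_divide_le_eq mult.commute)
  \<comment> \<open>The gap of u enters with total weight 1 + 1/4, so a gap below e/2 costs less
    than e.\<close>
  obtain u where u: "u \<in> rvec d" and Fu: "F u < opt_val d F + e / 2"
    using opt_val_approx[OF l sc sm, of "e / 2"] e by auto
  have gap0: "0 \<le> gap x0" using gap_nonneg x0 by simp
  have snd: "snd \<in> ?a \<rightarrow>\<^sub>M Rd d"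
    using x0 by (simp cong: measurable_cong_sets)
  have "(\<integral>\<^sup>+x. ennreal (gap x)
      \<partial>multi_acsa d Q [(T, \<lambda>t. (real t + 2) / 2, \<lambda>t. \<gamma> * (real t + 1) / 2)] x0)
      = (\<integral>\<^sup>+p. ennreal (gap (snd p)) \<partial>?a)"
    unfolding multi_acsa_single[OF x0] by (subst nn_integral_distr[OF snd]) auto
  also have "\<dots> \<le> (\<integral>\<^sup>+p. ennreal (1 / A) *
      ennreal (real T * (real T + 1) * gap (snd p) + 2 / \<gamma> * (vdist d (fst p) u)\<^sup>2) \<partial>?a)"
  proof (rule nn_integral_mono)
    fix p :: "(nat \<Rightarrow> real) \<times> (nat \<Rightarrow> real)"
    have "gap (snd p) = 1 / A * (real T * (real T + 1) * gap (snd p))" using T0 by (simp add: A_def)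
    also have "\<dots> \<le> 1 / A * (real T * (real T + 1) * gap (snd p) + 2 / \<gamma> * (vdist d (fst p) u)\<^sup>2)"
      using A \<gamma> by (intro mult_left_mono) auto
    finally show "ennreal (gap (snd p)) \<le> ennreal (1 / A) *
        ennreal (real T * (real T + 1) * gap (snd p) + 2 / \<gamma> * (vdist d (fst p) u)\<^sup>2)"
      using A by (subst ennreal_mult'[symmetric]) (auto intro: ennreal_leI)
  qed
  also have "\<dots> = ennreal (1 / A) *
      (\<integral>\<^sup>+p. ennreal (real T * (real T + 1) * gap (snd p) + 2 / \<gamma> * (vdist d (fst p) u)\<^sup>2) \<partial>?a)"
    using measurable_potential[OF u, of "real T * (real T + 1)" "2 / \<gamma>"] x0 by (intro nn_integral_cmult) (simp cong: measurable_cong_sets)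
  also have "\<dots> \<le> ennreal (1 / A) * ennreal (2 / \<gamma> * (vdist d x0 u)\<^sup>2 + real T * (real T + 1) * gap u
        + \<gamma> * s\<^sup>2 * ((real T)\<^sup>2 * (real T + 1) / 2))"
    by (intro mult_left_mono acsa_potential x0 u \<gamma> H\<gamma>) simp
  also have "\<dots> = ennreal (1 / A * (2 / \<gamma> * (vdist d x0 u)\<^sup>2 + real T * (real T + 1) * gap u
        + \<gamma> * s\<^sup>2 * ((real T)\<^sup>2 * (real T + 1) / 2)))"
    using A by (intro ennreal_mult'[symmetric]) simp
  also have "\<dots> \<le> ennreal ((1 / 4 * gap x0 + 16 * (s\<^sup>2 / (l * real T))) + e)"
  proof (rule ennreal_leI)
    have "1 / A * (2 / \<gamma> * (vdist d x0 u)\<^sup>2) = l / 16 * (real T / (real T + 1)) * (vdist d x0 u)\<^sup>2"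
    proof -
      have "2 / \<gamma> = l * (real T)\<^sup>2 / 16" by (simp add: \<gamma>_def)
      then have "1 / A * (2 / \<gamma> * (vdist d x0 u)\<^sup>2) = l / 16 * (1 / A * (real T)\<^sup>2) * (vdist d x0 u)\<^sup>2"
        by (simp only:) simp
      also have "1 / A * (real T)\<^sup>2 = real T / (real T + 1)"
        using T0 by (simp add: A_def power2_eq_square)
      finally show ?thesis .
    qed
    also have "\<dots> \<le> l / 16 * 1 * (vdist d x0 u)\<^sup>2"
      using l by (intro mult_right_mono mult_left_mono) auto
    also have "\<dots> \<le> l / 16 * 1 * (4 / l * (gap x0 + gap u))"
      using l by (intro mult_left_mono vdist_le_gaps[OF l sc sm x0 u]) auto
    also have "\<dots> = 1 / 4 * gap x0 + 1 / 4 * gap u" using l by (simp add: field_simps)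
    finally have 1: "1 / A * (2 / \<gamma> * (vdist d x0 u)\<^sup>2) \<le> 1 / 4 * gap x0 + 1 / 4 * gap u" .
    have 2: "1 / A * (real T * (real T + 1) * gap u) = gap u" using T0 by (simp add: A_def)
    have "1 / A * (\<gamma> * s\<^sup>2 * ((real T)\<^sup>2 * (real T + 1) / 2)) = \<gamma> * s\<^sup>2 * real T / 2"
      using T0 by (simp add: A_def power2_eq_square)
    also have "\<dots> = 16 * (s\<^sup>2 / (l * real T))"
      using T0 l by (simp add: \<gamma>_def power2_eq_square)
    finally have 3: "1 / A * (\<gamma> * s\<^sup>2 * ((real T)\<^sup>2 * (real T + 1) / 2)) = 16 * (s\<^sup>2 / (l * real T))" .
    have combine: "a + g + n \<le> 1 / 4 * x + n + e" if "a \<le> 1 / 4 * x + 1 / 4 * g" "g < e / 2" for a g n x :: real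
      using that e by linarith
    show "1 / A * (2 / \<gamma> * (vdist d x0 u)\<^sup>2 + real T * (real T + 1) * gap u
        + \<gamma> * s\<^sup>2 * ((real T)\<^sup>2 * (real T + 1) / 2)) \<le> (1 / 4 * gap x0 + 16 * (s\<^sup>2 / (l * real T))) + e"
      unfolding distrib_left[of "1 / A"] 2 3 by (rule combine[OF 1]) (use Fu in simp)
  qed
  also have "\<dots> = ennreal (1 / 4 * gap x0 + 16 * (s\<^sup>2 / (l * real T))) + ennreal e"
    using gap0 l T0 e by (intro ennreal_plus) auto
  finally show "(\<integral>\<^sup>+x. ennreal (gap x)
      \<partial>multi_acsa d Q [(T, \<lambda>t. (real t + 2) / 2, \<lambda>t. \<gamma> * (real t + 1) / 2)] x0)
    \<le> ennreal (1 / 4 * gap x0 + 16 * (s\<^sup>2 / (l * real T))) + ennreal e" .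
qed

text \<open>With step size 0 and mixing weight 1 the state never moves, whatever the oracle answers;
  discarding a sample costs nothing because its distribution has mass one. Such stages use up
  surplus iterations.\<close>

lemma acsa_idle:
  assumes x0: "x0 \<in> rvec d"
  shows "acsa d Q (\<lambda>_. 1) (\<lambda>_. 0) x0 t = return (Rd d \<Otimes>\<^sub>M Rd d) (x0, x0)"
proof (induction t)
  case (Suc t)
  have x0': "(\<lambda>i\<in>{..<d}. x0 i) = x0" "mix d 1 x0 x0 = x0"
    using x0 by (auto simp: mix_1 PiE_restrict)
  have p: "(x0, x0) \<in> space (Rd d \<Otimes>\<^sub>M Rd d)" using x0 by (simp add: space_pair_measure)
  have "acsa d Q (\<lambda>_. 1) (\<lambda>_. 0) x0 (Suc t) = acsa_step d Q 1 0 (x0, x0)"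
    unfolding acsa_Suc Suc.IH
    using bind_return[OF measurable_prob_algebraD[OF measurable_acsa_step] p] by simp
  also have "\<dots> = Q x0 \<bind> (\<lambda>_. return (Rd d \<Otimes>\<^sub>M Rd d) (x0, x0))"
    by (simp add: acsa_step_def acsa_update_def Let_def x0')
  also have "\<dots> = return (Rd d \<Otimes>\<^sub>M Rd d) (x0, x0)"
    using Q_prob[OF x0] p by (intro bind_const' prob_space_imp_subprob_space prob_space_return)
  finally show ?case .
qed simp

end

subsection \<open>Averages of independent samples\<close>

text \<open>It suffices to check cylinder boxes, an intersection-stable generator. There the product
  measure is a finite product of measurable functions of the parameter.\<close>

lemma measurable_PiM_kernel:
  assumes Q: "Q \<in> N \<rightarrow>\<^sub>M prob_algebra M"
  shows "(\<lambda>x. PiM I (\<lambda>_. Q x)) \<in> N \<rightarrow>\<^sub>M prob_algebra (PiM I (\<lambda>_. M))"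
proof (rule measurable_prob_algebra_generated[OF sets_PiM Int_stable_prod_algebra prod_algebra_sets_into_space])
  have Qx: "prob_space (Q x)" "sets (Q x) = sets M" "space (Q x) = space M" if "x \<in> space N" for x
    using measurable_space[OF Q that] by (auto simp: space_prob_algebra dest: sets_eq_imp_space_eq)
  fix x assume "x \<in> space N"
  with Qx show "prob_space (PiM I (\<lambda>_. Q x))" "sets (PiM I (\<lambda>_. Q x)) = sets (PiM I (\<lambda>_. M))"
    by (auto intro!: prob_space_PiM sets_PiM_cong)
next
  have Qx: "prob_space (Q x)" "sets (Q x) = sets M" "space (Q x) = space M" if "x \<in> space N" for x
    using measurable_space[OF Q that] by (auto simp: space_prob_algebra dest: sets_eq_imp_space_eq)
  fix A assume "A \<in> prod_algebra I (\<lambda>_. M)"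
  then obtain J E where A: "A = prod_emb I (\<lambda>_. M) J (Pi\<^sub>E J E)"
    and J: "finite J" "J \<subseteq> I" and E: "\<And>i. i \<in> J \<Longrightarrow> E i \<in> sets M"
    by (elim prod_algebraE) blast
  have "emeasure (PiM I (\<lambda>_. Q x)) A = (\<Prod>i\<in>J. emeasure (Q x) (E i))" if x: "x \<in> space N" for x
  proof -
    have "A = prod_emb I (\<lambda>_. Q x) J (Pi\<^sub>E J E)" by (simp add: A prod_emb_def Qx[OF x])
    then show ?thesis using J E Qx[OF x] by (simp add: emeasure_PiM_emb)
  qed
  moreover have "(\<lambda>x. \<Prod>i\<in>J. emeasure (Q x) (E i)) \<in> borel_measurable N"
    using E measurable_emeasure_kernel[OF measurable_prob_algebraD[OF Q]]
    by (intro borel_measurable_prod_ennreal) auto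
  ultimately show "(\<lambda>x. emeasure (PiM I (\<lambda>_. Q x)) A) \<in> borel_measurable N"
    by (simp cong: measurable_cong)
qed

locale iid_samples = prob_space P for P :: "'b measure" +
  fixes I :: "'i set"
  assumes finite_I: "finite I"
begin

sublocale prod: product_prob_space "\<lambda>_. P" I
  by unfold_locales

lemma integrable_component:
  fixes f :: "'b \<Rightarrow> real"
  assumes "p \<in> I" "integrable P f"
  shows "integrable (PiM I (\<lambda>_. P)) (\<lambda>z. f (z p))" "(LINT z|PiM I (\<lambda>_. P). f (z p)) = (LINT y|P. f y)"
proof -
  have m: "(\<lambda>z. z p) \<in> PiM I (\<lambda>_. P) \<rightarrow>\<^sub>M P" using assms by measurable
  have d: "distr (PiM I (\<lambda>_. P)) P (\<lambda>z. z p) = P"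
    using assms by (rule_tac prod.PiM_component)
  show "integrable (PiM I (\<lambda>_. P)) (\<lambda>z. f (z p))"
    using integrable_distr[OF m, of f] assms by (simp add: d)
  show "(LINT z|PiM I (\<lambda>_. P). f (z p)) = (LINT y|P. f y)"
    using integral_distr[OF m, of f] assms by (simp add: d)
qed

text \<open>The product of two coordinates is written as a product over all of I with constant
  factors 1 elsewhere, so that integrals factorise; the factor at p is 0.\<close>

lemma uncorrelated_components:
  fixes f :: "'b \<Rightarrow> real"
  assumes p: "p \<in> I" and q: "q \<in> I" and "p \<noteq> q" and f: "integrable P f" and f0: "(LINT y|P. f y) = 0"
  shows "integrable (PiM I (\<lambda>_. P)) (\<lambda>z. f (z p) * f (z q))"
    "(LINT z|PiM I (\<lambda>_. P). f (z p) * f (z q)) = 0"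
proof -
  define h where "h r y = (if r \<in> {p, q} then f y else 1)" for r y
  have h: "integrable P (h r)" for r
    using f by (cases "r \<in> {p, q}") (auto simp: h_def[abs_def])
  have eq: "(\<Prod>r\<in>I. h r (z r)) = f (z p) * f (z q)" for z
  proof -
    have "(\<Prod>r\<in>I. h r (z r)) = (\<Prod>r\<in>I \<inter> {p, q}. f (z r))"
      unfolding h_def by (rule prod.inter_restrict[OF finite_I, symmetric])
    also have "I \<inter> {p, q} = {p, q}" using p q by auto
    finally show ?thesis using \<open>p \<noteq> q\<close> by simp
  qed
  show "integrable (PiM I (\<lambda>_. P)) (\<lambda>z. f (z p) * f (z q))"
    using prod.product_integrable_prod[OF finite_I, of h] h by (simp add: eq)
  have "(LINT z|PiM I (\<lambda>_. P). f (z p) * f (z q)) = (\<Prod>r\<in>I. LINT y|P. h r y)"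
    using prod.product_integral_prod[OF finite_I, of h] h by (simp add: eq)
  also have "\<dots> = 0"
    using p f0 finite_I by (intro prod_zero bexI[of _ p]) (simp_all add: h_def)
  finally show "(LINT z|PiM I (\<lambda>_. P). f (z p) * f (z q)) = 0" .
qed

text \<open>In the expanded square only the diagonal terms survive, by
  \<open>uncorrelated_components\<close>.\<close>

lemma sum_components_square:
  fixes f :: "'b \<Rightarrow> real"
  assumes f: "integrable P f" and f0: "(LINT y|P. f y) = 0" and f2: "integrable P (\<lambda>y. (f y)\<^sup>2)"
  shows "integrable (PiM I (\<lambda>_. P)) (\<lambda>z. (\<Sum>p\<in>I. f (z p))\<^sup>2)"
    "(LINT z|PiM I (\<lambda>_. P). (\<Sum>p\<in>I. f (z p))\<^sup>2) = card I * (LINT y|P. (f y)\<^sup>2)"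
proof -
  have eq: "(\<Sum>p\<in>I. f (z p))\<^sup>2 = (\<Sum>p\<in>I. \<Sum>q\<in>I. f (z p) * f (z q))" for z
    by (simp add: power2_eq_square sum_product)
  have int: "integrable (PiM I (\<lambda>_. P)) (\<lambda>z. f (z p) * f (z q))" if "p \<in> I" "q \<in> I" for p q
    using uncorrelated_components(1)[OF that _ f f0] integrable_component(1)[OF that(1) f2]
    by (cases "p = q") (simp_all add: power2_eq_square)
  have val: "(LINT z|PiM I (\<lambda>_. P). f (z p) * f (z q)) = (if q = p then LINT y|P. (f y)\<^sup>2 else 0)"
    if "p \<in> I" "q \<in> I" for p q
    using uncorrelated_components(2)[OF that _ f f0] integrable_component(2)[OF that(1) f2]
    by (cases "p = q") (simp_all add: power2_eq_square)
  show "integrable (PiM I (\<lambda>_. P)) (\<lambda>z. (\<Sum>p\<in>I. f (z p))\<^sup>2)"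
    unfolding eq using int by (intro Bochner_Integration.integrable_sum)
  have "(LINT z|PiM I (\<lambda>_. P). (\<Sum>p\<in>I. f (z p))\<^sup>2)
      = (\<Sum>p\<in>I. \<Sum>q\<in>I. LINT z|PiM I (\<lambda>_. P). f (z p) * f (z q))"
    unfolding eq using int by (simp add: Bochner_Integration.integral_sum Bochner_Integration.integrable_sum)
  also have "\<dots> = (\<Sum>p\<in>I. LINT y|P. (f y)\<^sup>2)"
    using finite_I by (intro sum.cong) (simp_all add: val)
  finally show "(LINT z|PiM I (\<lambda>_. P). (\<Sum>p\<in>I. f (z p))\<^sup>2) = card I * (LINT y|P. (f y)\<^sup>2)" by simp
qed

end

text \<open>Variances of independent centred samples add up, and averaging divides by the square of
  their number, so each coordinate gains a factor \<open>1 / n\<close> with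
  \<open>n = M * K\<close>. Minibatching is thus just a less noisy oracle for the same
  function.\<close>

lemma grad_oracle_minibatch:
  assumes orc: "grad_oracle d F \<sigma> Q" and M: "1 \<le> M" and K: "1 \<le> K"
  shows "grad_oracle d F (\<sigma> / sqrt (real M * real K)) (minibatch d M K Q)"
proof -
  define n where "n = real M * real K"
  define I where "I = {..<M} \<times> {..<K}"
  have n: "0 < n" "real (card I) = n" "finite I" using M K by (simp_all add: n_def I_def)
  interpret kernel d Q using orc by unfold_locales (simp add: grad_oracle_def)
  define avg where "avg z = (\<lambda>i\<in>{..<d}. (\<Sum>p\<in>I. z p i) / n)" for z :: "nat \<times> nat \<Rightarrow> nat \<Rightarrow> real"
  have mb: "minibatch d M K Q x = distr (PiM I (\<lambda>_. Q x)) (Rd d) avg" for x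
    by (simp add: minibatch_def avg_def[abs_def] I_def n_def)
  have avg_meas: "avg \<in> PiM I (\<lambda>_. Rd d) \<rightarrow>\<^sub>M Rd d"
    unfolding avg_def
  proof (rule measurable_restrict)
    fix i assume i: "i \<in> {..<d}"
    have "(\<lambda>z. z p i) \<in> borel_measurable (PiM I (\<lambda>_. Rd d))" if "p \<in> I" for p
      using measurable_compose[OF measurable_component_singleton[OF that] measurable_component_singleton[OF i]] .
    then show "(\<lambda>z. (\<Sum>p\<in>I. z p i) / n) \<in> borel_measurable (PiM I (\<lambda>_. Rd d))" by measurable
  qed
  show ?thesis unfolding grad_oracle_def
  proof (intro conjI ballI)
    show "minibatch d M K Q \<in> Rd d \<rightarrow>\<^sub>M prob_algebra (Rd d)"
      using measurable_compose[OF measurable_PiM_kernel[OF Q] measurable_distr_prob_space[OF avg_meas]]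
      by (simp add: mb[abs_def])
  next
    fix x assume x: "x \<in> rvec d"
    have "\<forall>x\<in>rvec d. \<exists>g. has_gradient d F g x \<and>
        (\<forall>i<d. integrable (Q x) (\<lambda>z. z i) \<and> (LINT z|Q x. z i) = g i) \<and>
        integrable (Q x) (\<lambda>z. (vdist d z g)\<^sup>2) \<and> (LINT z|Q x. (vdist d z g)\<^sup>2) \<le> \<sigma>\<^sup>2"
      using orc[unfolded grad_oracle_def] by (elim conjE)
    from bspec[OF this x] obtain g where g: "has_gradient d F g x"
      and int: "\<And>i. i < d \<Longrightarrow> integrable (Q x) (\<lambda>z. z i)" and mean: "\<And>i. i < d \<Longrightarrow> (LINT z|Q x. z i) = g i"
      and int2: "integrable (Q x) (\<lambda>z. (vdist d z g)\<^sup>2)" and var: "(LINT z|Q x. (vdist d z g)\<^sup>2) \<le> \<sigma>\<^sup>2"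
      by meson
    interpret iid_samples "Q x" I
      using n Q_prob[OF x] by (simp add: iid_samples_def iid_samples_axioms_def)
    let ?P = "PiM I (\<lambda>_. Q x)"
    have avg_meas': "avg \<in> ?P \<rightarrow>\<^sub>M Rd d"
      using avg_meas x by (simp cong: measurable_cong_sets sets_PiM_cong)
    define h where "h i z = z i - g i" for i and z :: "nat \<Rightarrow> real"
    have h: "integrable (Q x) (h i)" "(LINT z|Q x. h i z) = 0" "integrable (Q x) (\<lambda>z. (h i z)\<^sup>2)"
      if i: "i < d" for i
    proof -
      show "integrable (Q x) (h i)" "(LINT z|Q x. h i z) = 0"
        using int[OF i] mean[OF i] by (simp_all add: h_def[abs_def] prob_space)
      then have [measurable]: "h i \<in> borel_measurable (Q x)" by simp
      show "integrable (Q x) (\<lambda>z. (h i z)\<^sup>2)"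
      \<comment> \<open>A single squared coordinate is dominated by the squared distance, which is
        integrable for the given oracle.\<close>
      proof (rule Bochner_Integration.integrable_bound[OF int2])
        show "AE z in Q x. norm ((h i z)\<^sup>2) \<le> norm ((vdist d z g)\<^sup>2)"
          using i by (intro AE_I2) (auto simp: vdist_square h_def sum_nonneg intro!: member_le_sum)
      qed measurable
    qed
    have avg_i: "avg z i = (\<Sum>p\<in>I. z p i) / n" if "i < d" for z i
      using that by (simp add: avg_def)
    have dist_avg: "(vdist d (avg z) g)\<^sup>2 = (\<Sum>i<d. (\<Sum>p\<in>I. h i (z p))\<^sup>2 / n\<^sup>2)" for z
    proof -
      have "avg z i - g i = (\<Sum>p\<in>I. h i (z p)) / n" if "i < d" for i
        using n that by (simp add: avg_i h_def sum_subtractf field_simps)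
      then show ?thesis by (simp add: vdist_square power_divide)
    qed
    have dist_meas: "(\<lambda>z. (vdist d z g)\<^sup>2) \<in> borel_measurable (Rd d)"
      unfolding vdist_square by measurable
    have int_sq: "integrable ?P (\<lambda>z. (\<Sum>p\<in>I. h i (z p))\<^sup>2)"
      and lint_sq: "(LINT z|?P. (\<Sum>p\<in>I. h i (z p))\<^sup>2) = n * (LINT z|Q x. (h i z)\<^sup>2)" if "i < d" for i
      using sum_components_square[OF h[OF that]] n by simp_all
    show "\<exists>g. has_gradient d F g x \<and>
        (\<forall>i<d. integrable (minibatch d M K Q x) (\<lambda>z. z i) \<and> (LINT z|minibatch d M K Q x. z i) = g i) \<and>
        integrable (minibatch d M K Q x) (\<lambda>z. (vdist d z g)\<^sup>2) \<and>
        (LINT z|minibatch d M K Q x. (vdist d z g)\<^sup>2) \<le> (\<sigma> / sqrt (real M * real K))\<^sup>2"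
    proof (intro exI[of _ g] conjI allI impI g)
      fix i assume i: "i < d"
      have comp: "(\<lambda>z. z i) \<in> borel_measurable (Rd d)"
        using i by (intro measurable_component_singleton) simp
      show "integrable (minibatch d M K Q x) (\<lambda>z. z i)"
        unfolding mb using integrable_component(1)[OF _ int[OF i]]
        by (subst integrable_distr_eq[OF avg_meas' comp])
          (simp add: avg_i[OF i] Bochner_Integration.integrable_sum)
      have "(LINT z|minibatch d M K Q x. z i) = (LINT z|?P. (\<Sum>p\<in>I. z p i) / n)"
        unfolding mb by (subst integral_distr[OF avg_meas' comp]) (simp add: avg_i[OF i])
      also have "\<dots> = (\<Sum>p\<in>I. g i) / n"
        using integrable_component[OF _ int[OF i]] mean[OF i]
        by (simp add: Bochner_Integration.integral_sum)
      finally show "(LINT z|minibatch d M K Q x. z i) = g i" using n by simp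
    next
      show "integrable (minibatch d M K Q x) (\<lambda>z. (vdist d z g)\<^sup>2)"
        unfolding mb integrable_distr_eq[OF avg_meas' dist_meas] dist_avg
        by (intro Bochner_Integration.integrable_sum integrable_divide int_sq) simp
      have "(LINT z|minibatch d M K Q x. (vdist d z g)\<^sup>2) = (\<Sum>i<d. n * (LINT z|Q x. (h i z)\<^sup>2) / n\<^sup>2)"
        unfolding mb using int_sq lint_sq
        by (subst integral_distr[OF avg_meas' dist_meas])
          (simp add: dist_avg Bochner_Integration.integral_sum)
      also have "\<dots> = (LINT z|Q x. (vdist d z g)\<^sup>2) / n"
        unfolding vdist_square h_def[symmetric] using n h(3)
        by (subst Bochner_Integration.integral_sum) (simp_all add: sum_divide_distrib power2_eq_square)
      also have "\<dots> \<le> \<sigma>\<^sup>2 / n" using var n by (intro divide_right_mono) auto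
      finally show "(LINT z|minibatch d M K Q x. (vdist d z g)\<^sup>2) \<le> (\<sigma> / sqrt (real M * real K))\<^sup>2"
        using n by (simp add: power_divide n_def)
    qed
  qed
qed

subsection \<open>Multi-stage schedules\<close>

text \<open>Padding that keeps the point fixed. Valid stages have length at least 1, hence the empty
  list for 0.\<close>

definition idle :: "nat \<Rightarrow> stage list" where
  "idle N = (if N = 0 then [] else [(N, \<lambda>_. 1, \<lambda>_. 0)])"

text \<open>An affine bound on the expected gap, uniform in dimension, function, oracle and starting
  point. Allowing any start makes it compose over random restarts; the uniformity lets one schedule
  serve all problems.\<close>

definition achieves :: "real \<Rightarrow> real \<Rightarrow> real \<Rightarrow> stage list \<Rightarrow> real \<Rightarrow> real \<Rightarrow> bool" where
  "achieves l H s ss A B \<longleftrightarrow>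
     (\<forall>d F Q x. noisy_problem d F l H s Q \<longrightarrow> x \<in> rvec d \<longrightarrow>
        (\<integral>\<^sup>+y. ennreal (F y - opt_val d F) \<partial>multi_acsa d Q ss x)
          \<le> ennreal (A * (F x - opt_val d F) + B))"

lemma valid_schedule_idle: "valid_schedule N (idle N)"
  by (simp add: valid_schedule_def idle_def)

lemma valid_schedule_append:
  "valid_schedule N ss \<Longrightarrow> valid_schedule N' ss' \<Longrightarrow> valid_schedule (N + N') (ss @ ss')"
  unfolding valid_schedule_def by (simp add: ball_Un)

lemma achieves_idle: "achieves l H s (idle N) 1 0"
  unfolding achieves_def
proof (intro allI impI)
  fix d F Q x assume "noisy_problem d F l H s Q" and x: "x \<in> rvec d"
  then interpret noisy_problem d F l H s Q by simp
  have "multi_acsa d Q (idle N) x = return (Rd d) x"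
  proof (cases "N = 0")
    case False
    then show ?thesis using x
      by (simp add: idle_def multi_acsa_single acsa_idle distr_return space_pair_measure
          del: multi_acsa.simps)
  qed (simp add: idle_def)
  then show "(\<integral>\<^sup>+y. ennreal (F y - opt_val d F) \<partial>multi_acsa d Q (idle N) x)
      \<le> ennreal (1 * (F x - opt_val d F) + 0)"
    using x by (simp add: nn_integral_return)
qed

lemma achieves_mono:
  assumes "achieves l H s ss A B" "A \<le> A'" "B \<le> B'"
  shows "achieves l H s ss A' B'"
  unfolding achieves_def
proof (intro allI impI)
  fix d F Q x assume prem: "noisy_problem d F l H s Q" "x \<in> rvec d"
  interpret noisy_problem d F l H s Q by (rule prem)
  have "(\<integral>\<^sup>+y. ennreal (gap y) \<partial>multi_acsa d Q ss x) \<le> ennreal (A * gap x + B)"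
    using assms prem unfolding achieves_def by simp
  also have "\<dots> \<le> ennreal (A' * gap x + B')"
    using assms gap_nonneg[OF prem(2)] by (intro ennreal_leI add_mono mult_right_mono) auto
  finally show "(\<integral>\<^sup>+y. ennreal (gap y) \<partial>multi_acsa d Q ss x) \<le> ennreal (A' * gap x + B')" .
qed

text \<open>Conditioned on the intermediate point, the second bound is affine in its gap, so
  integrating it and inserting the first bound composes the two affine maps.\<close>

lemma achieves_append:
  assumes 1: "achieves l H s ss A B" and 2: "achieves l H s ss' A' B'"
    and nonneg: "0 \<le> A" "0 \<le> B" "0 \<le> A'" "0 \<le> B'"
  shows "achieves l H s (ss @ ss') (A' * A) (A' * B + B')"
  unfolding achieves_def
proof (intro allI impI)
  fix d F Q x assume prem: "noisy_problem d F l H s Q" "x \<in> rvec d"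
  interpret noisy_problem d F l H s Q by (rule prem)
  let ?M = "multi_acsa d Q ss x"
  interpret M: prob_space ?M by (rule multi_acsa_prob[OF prem(2)])
  have spM: "space ?M = rvec d" using sets_eq_imp_space_eq[OF multi_acsa_sets[OF prem(2)]] by simp
  have mF: "(\<lambda>y. ennreal (gap y)) \<in> borel_measurable (Rd d)" by measurable
  have "(\<integral>\<^sup>+y. ennreal (gap y) \<partial>multi_acsa d Q (ss @ ss') x)
      = (\<integral>\<^sup>+y. (\<integral>\<^sup>+z. ennreal (gap z) \<partial>multi_acsa d Q ss' y) \<partial>?M)"
    unfolding multi_acsa_append[OF prem(2)]
    using measurable_prob_algebraD[OF measurable_multi_acsa[of ss']] prem(2)
    by (intro nn_integral_bind[OF mF]) (simp cong: measurable_cong_sets)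
  also have "\<dots> \<le> (\<integral>\<^sup>+y. ennreal A' * ennreal (gap y) + ennreal B' \<partial>?M)"
  proof (rule nn_integral_mono)
    fix y assume "y \<in> space ?M"
    then have y: "y \<in> rvec d" by (simp add: spM)
    have "(\<integral>\<^sup>+z. ennreal (gap z) \<partial>multi_acsa d Q ss' y) \<le> ennreal (A' * gap y + B')"
      using 2 prem(1) y unfolding achieves_def by simp
    also have "\<dots> = ennreal A' * ennreal (gap y) + ennreal B'"
      using nonneg gap_nonneg[OF y] by (simp add: ennreal_mult)
    finally show "(\<integral>\<^sup>+z. ennreal (gap z) \<partial>multi_acsa d Q ss' y) \<le> ennreal A' * ennreal (gap y) + ennreal B'" .
  qed
  also have "\<dots> = ennreal A' * (\<integral>\<^sup>+y. ennreal (gap y) \<partial>?M) + ennreal B'"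
    using mF prem(2) by (subst nn_integral_add; (subst nn_integral_cmult)?)
      (simp_all add: M.emeasure_space_1 cong: measurable_cong_sets)
  also have "\<dots> \<le> ennreal A' * ennreal (A * gap x + B) + ennreal B'"
    using 1 prem unfolding achieves_def by (intro add_right_mono mult_left_mono) auto
  also have "\<dots> = ennreal (A' * A * gap x + (A' * B + B'))"
    using nonneg gap_nonneg[OF prem(2)]
    by (simp add: ennreal_mult[symmetric] ennreal_plus[symmetric] distrib_left mult.assoc del: ennreal_plus)
  finally show "(\<integral>\<^sup>+y. ennreal (gap y) \<partial>multi_acsa d Q (ss @ ss') x)
      \<le> ennreal (A' * A * gap x + (A' * B + B'))" .
qed

section \<open>Construction of the schedules\<close>

lemma exists_stage:
  assumes l: "0 < l" and H: "0 < H" and T: "1 \<le> T" "6 * sqrt (H / l) \<le> real T"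
  obtains st where "valid_schedule T [st]" "achieves l H s [st] (1 / 4) (16 * (s\<^sup>2 / (l * real T)))"
proof
  let ?\<gamma> = "32 / (l * (real T)\<^sup>2)"
  let ?st = "(T, \<lambda>t. (real t + 2) / 2, \<lambda>t. ?\<gamma> * (real t + 1) / 2)"
  show "valid_schedule T [?st]"
    using l T by (simp add: valid_schedule_def)
  show "achieves l H s [?st] (1 / 4) (16 * (s\<^sup>2 / (l * real T)))"
    unfolding achieves_def
  proof (intro allI impI)
    fix d F Q x assume prem: "noisy_problem d F l H s Q" "x \<in> rvec d"
    show "(\<integral>\<^sup>+y. ennreal (F y - opt_val d F) \<partial>multi_acsa d Q [?st] x)
        \<le> ennreal (1 / 4 * (F x - opt_val d F) + 16 * (s\<^sup>2 / (l * real T)))"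
      by (rule noisy_problem.stage_contraction[OF prem(1) H T prem(2)])
  qed
qed

text \<open>Each appended stage of length n quarters the bound, and the noise coefficient stays
  below 32 because 32/4 + 16 = 24. A remainder shorter than n is spent idling.\<close>

lemma exists_constant_length_schedule:
  assumes l: "0 < l" and H: "0 < H" and n: "1 \<le> n" "6 * sqrt (H / l) \<le> real n"
  shows "\<exists>ss. valid_schedule N ss \<and> achieves l H s ss ((1 / 4) ^ (N div n)) (32 * (s\<^sup>2 / (l * real n)))"
proof (induction N rule: less_induct)
  case (less N)
  let ?X = "s\<^sup>2 / (l * real n)"
  have X: "0 \<le> ?X" using l by simp
  show ?case
  proof (cases "N < n")
    case True
    then have "achieves l H s (idle N) ((1 / 4) ^ (N div n)) (32 * ?X)"
      using X by (intro achieves_mono[OF achieves_idle]) simp_all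
    then show ?thesis using valid_schedule_idle by blast
  next
    case False
    then obtain ss where ss: "valid_schedule (N - n) ss"
      "achieves l H s ss ((1 / 4) ^ ((N - n) div n)) (32 * ?X)"
      using less.IH[of "N - n"] n by auto
    obtain st where st: "valid_schedule n [st]" "achieves l H s [st] (1 / 4) (16 * ?X)"
      using exists_stage[OF l H n] .
    have "valid_schedule N (ss @ [st])"
      using valid_schedule_append[OF ss(1) st(1)] False by simp
    moreover have "achieves l H s (ss @ [st]) (1 / 4 * (1 / 4) ^ ((N - n) div n)) (1 / 4 * (32 * ?X) + 16 * ?X)"
      using X by (intro achieves_append ss st) auto
    then have "achieves l H s (ss @ [st]) ((1 / 4) ^ (N div n)) (32 * ?X)"
      using False n X by (elim achieves_mono) (simp_all add: le_div_geq)
    ultimately show ?thesis by blast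
  qed
qed

lemma real_le_three_halves:
  fixes N :: nat
  assumes "2 \<le> N"
  shows "real N \<le> 3 * real (N div 2)"
proof -
  have "N \<le> 3 * (N div 2)" using assms by presburger
  then have "real N \<le> real (3 * (N div 2))" by (rule of_nat_mono)
  then show ?thesis by simp
qed

text \<open>A last stage on about half of the budget follows a schedule for the other half. The
  noise bound inherited from that half is quartered while it is at most three times the target, so
  128 reproduces itself: 3 * 128 / 4 + 2 * 16 = 128.\<close>

lemma exists_doubling_schedule:
  assumes l: "0 < l" and H: "0 < H" and n: "1 \<le> n" "6 * sqrt (H / l) \<le> real n"
    and ss0: "valid_schedule N0 ss0" "achieves l H s ss0 A (32 * (s\<^sup>2 / (l * real n)))" and A: "0 \<le> A"
  shows "n \<le> N \<Longrightarrow> \<exists>ss. valid_schedule (N0 + N) ss \<and> achieves l H s ss A (128 * (s\<^sup>2 / (l * real N)))"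
proof (induction N rule: less_induct)
  case (less N)
  have N: "0 < real N" using less.prems n by simp
  define Y where "Y = s\<^sup>2 / l"
  have Y: "0 \<le> Y" using l by (simp add: Y_def)
  have Y_eq: "s\<^sup>2 / (l * r) = Y / r" for r by (simp add: Y_def)
  show ?case
  proof (cases "N < 2 * n")
    \<comment> \<open>Below twice the minimal length the extra iterations idle; the prior noise
      level suffices since N is less than 4 * n.\<close>
    case True
    have "achieves l H s (ss0 @ idle N) (1 * A) (1 * (32 * (s\<^sup>2 / (l * real n))) + 0)"
      using A l by (intro achieves_append ss0 achieves_idle) auto
    moreover have "32 * (Y / real n) \<le> 128 * (Y / real N)"
    proof -
      have "32 * (Y / real n) = (32 * Y) / real n" by simp
      also have "\<dots> \<le> (32 * Y) / (real N / 4)"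
        using True n N Y by (intro divide_left_mono) auto
      finally show ?thesis by simp
    qed
    ultimately have "achieves l H s (ss0 @ idle N) A (128 * (s\<^sup>2 / (l * real N)))"
      by (elim achieves_mono) (simp_all add: Y_eq)
    then show ?thesis using valid_schedule_append[OF ss0(1) valid_schedule_idle] by blast
  next
    case False
    define N' where "N' = N div 2"
    have N': "N' < N" "n \<le> N'" "n \<le> N - N'" "real N \<le> 3 * real N'" "real N / 2 \<le> real (N - N')"
      using False n real_le_three_halves[of N] by (auto simp: N'_def)
    obtain ss where ss: "valid_schedule (N0 + N') ss" "achieves l H s ss A (128 * (s\<^sup>2 / (l * real N')))"
      using less.IH[OF N'(1,2)] by blast
    have T: "1 \<le> N - N'" "6 * sqrt (H / l) \<le> real (N - N')" using N' n by auto
    obtain st where st: "valid_schedule (N - N') [st]"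
      "achieves l H s [st] (1 / 4) (16 * (s\<^sup>2 / (l * real (N - N'))))"
      using exists_stage[OF l H T] .
    have "valid_schedule (N0 + N) (ss @ [st])"
      using valid_schedule_append[OF ss(1) st(1)] N' by (simp add: add.assoc)
    moreover have "achieves l H s (ss @ [st]) (1 / 4 * A)
        (1 / 4 * (128 * (s\<^sup>2 / (l * real N'))) + 16 * (s\<^sup>2 / (l * real (N - N'))))"
      using A l by (intro achieves_append ss st) auto
    then have "achieves l H s (ss @ [st]) A (128 * (s\<^sup>2 / (l * real N)))"
    proof (rule achieves_mono)
      \<comment> \<open>The two halves satisfy \<open>N' \<ge> N / 3\<close> and
        \<open>N - N' \<ge> N / 2\<close>. The additional contraction of A is given away.\<close>
      have pos: "0 < real N'" "0 < real (N - N')" using N' n by linarith+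
      have "Y / real N' \<le> Y / (real N / 3)"
        using N' N Y pos(1) by (intro divide_left_mono mult_pos_pos) linarith+
      moreover have "Y / real (N - N') \<le> Y / (real N / 2)"
        using N' N Y pos(2) by (intro divide_left_mono mult_pos_pos) linarith+
      ultimately show "1 / 4 * (128 * (s\<^sup>2 / (l * real N'))) + 16 * (s\<^sup>2 / (l * real (N - N')))
          \<le> 128 * (s\<^sup>2 / (l * real N))"
        unfolding Y_eq by simp
    qed (use A in simp)
    ultimately show ?thesis by blast
  qed
qed

text \<open>With \<open>k = sqrt (l / H)\<close> the minimal length satisfies
  \<open>k * n \<le> 7\<close>, because \<open>k \<le> 1\<close>. Half of the budget holds m
  constant-length stages with \<open>N \<le> 6 * m * n\<close>, so
  \<open>k * N \<le> 42 * m\<close>; this is the origin of 1/42. The other half has length at least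
  N/2, which doubles the noise constant 128.\<close>

lemma exists_schedule:
  assumes l: "0 < l" and H: "0 < H" and lH: "l \<le> H"
  shows "\<exists>ss. valid_schedule N ss \<and>
    achieves l H s ss (2 * exp (- (1 / 42 * sqrt l * real N / sqrt H))) (256 * (s\<^sup>2 / (l * real N)))"
proof -
  define k where "k = sqrt l / sqrt H"
  have k: "0 < k" "k \<le> 1" using l H lH by (simp_all add: k_def)
  have k_inv: "sqrt (H / l) = 1 / k" by (simp add: k_def real_sqrt_divide)
  have e: "1 / 42 * sqrt l * real N / sqrt H = k * real N / 42" by (simp add: k_def)
  define n where "n = nat \<lceil>6 * sqrt (H / l)\<rceil>"
  have n: "6 * sqrt (H / l) \<le> real n" and n_le: "real n \<le> 6 * sqrt (H / l) + 1"
    using H l by (simp_all add: n_def)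
  have "0 < 6 * sqrt (H / l)" using H l by simp
  with n have n1: "1 \<le> n" by (cases n) auto
  have "k * real n \<le> k * (6 * (1 / k) + 1)" using n_le k by (intro mult_left_mono) (auto simp: k_inv)
  also have "\<dots> \<le> 7" using k by (simp add: distrib_left)
  finally have kn: "k * real n \<le> 7" .
  show ?thesis
  proof (cases "N < 2 * n")
    \<comment> \<open>Two stages do not fit, but then the exponent is at most 1/2 in absolute value
      and the factor 2 in front makes the bound no smaller than the initial gap.\<close>
    case True
    have "k * real N \<le> k * (2 * real n)" using True k by (intro mult_left_mono) auto
    then have "k * real N / 42 \<le> 1 / 2" using kn by simp
    then have "1 / 2 \<le> exp (- (k * real N / 42))"
      using exp_ge_add_one_self[of "- (k * real N / 42)"] by linarith
    then have "achieves l H s (idle N) (2 * exp (- (k * real N / 42))) (256 * (s\<^sup>2 / (l * real N)))"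
      using l by (intro achieves_mono[OF achieves_idle]) auto
    then show ?thesis using valid_schedule_idle e by metis
  next
    case False
    define N1 where "N1 = N div 2"
    define m where "m = N1 div n"
    have N1: "n \<le> N1" "n \<le> N - N1" "real N \<le> 3 * real N1" "real N / 2 \<le> real (N - N1)" "N1 + (N - N1) = N"
      using False n1 real_le_three_halves[of N] by (auto simp: N1_def)
    obtain ss0 where ss0: "valid_schedule N1 ss0"
      "achieves l H s ss0 ((1 / 4) ^ m) (32 * (s\<^sup>2 / (l * real n)))"
      using exists_constant_length_schedule[OF l H n1 n] unfolding m_def by blast
    obtain ss where ss: "valid_schedule N ss"
      "achieves l H s ss ((1 / 4) ^ m) (128 * (s\<^sup>2 / (l * real (N - N1))))"
      using exists_doubling_schedule[OF l H n1 n ss0 _ N1(2)] N1(5) by auto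
    \<comment> \<open>At least one full stage fits, so rounding in the division costs at most a
      factor 2: \<open>m + 1 \<le> 2 * m\<close>.\<close>
    have m1: "1 \<le> m" using N1(1) n1 by (simp add: m_def div_greater_zero_iff Suc_le_eq)
    have "N1 < (m + 1) * n" using n1 by (simp add: m_def dividend_less_div_times)
    also have "\<dots> \<le> 2 * m * n" using m1 by (intro mult_right_mono) auto
    finally have "real N1 \<le> real (2 * m * n)" by (intro of_nat_mono) simp
    then have "real N \<le> 6 * real m * real n" using N1(3) by simp
    then have "k * real N \<le> k * (6 * real m * real n)" using k by (intro mult_left_mono) auto
    also have "\<dots> = 6 * real m * (k * real n)" by simp
    also have "\<dots> \<le> 6 * real m * 7" using kn by (intro mult_left_mono) auto
    finally have km: "k * real N / 42 \<le> real m" by simp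
    have "exp (1::real) \<le> 4" using exp_le by simp
    then have "1 / 4 \<le> exp (- 1 :: real)" by (simp add: exp_minus field_simps)
    then have "(1 / 4) ^ m \<le> exp (- 1 :: real) ^ m" by (intro power_mono) auto
    also have "\<dots> = exp (- real m)" by (simp add: exp_of_nat_mult[symmetric])
    also have "\<dots> \<le> exp (- (k * real N / 42))" using km by simp
    also have "\<dots> \<le> 2 * exp (- (k * real N / 42))" by simp
    finally have pow: "(1 / 4) ^ m \<le> 2 * exp (- (k * real N / 42))" .
    have "128 * (s\<^sup>2 / (l * real (N - N1))) = 128 * s\<^sup>2 / l / real (N - N1)" by simp
    also have "\<dots> \<le> 128 * s\<^sup>2 / l / (real N / 2)"
      using N1 False n1 l by (intro divide_left_mono mult_pos_pos) auto
    also have "\<dots> = 256 * (s\<^sup>2 / (l * real N))" by simp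
    finally have "128 * (s\<^sup>2 / (l * real (N - N1))) \<le> 256 * (s\<^sup>2 / (l * real N))" .
    with achieves_mono[OF ss(2) pow] ss(1) show ?thesis unfolding e by blast
  qed
qed

section \<open>From affine gap bounds to guarantees for the two algorithms\<close>

lemma achieves_expected_gap:
  assumes ach: "achieves l H s ss A B" and l: "0 < l" and AB: "0 \<le> A" "0 \<le> B"
    and F: "F \<in> fun_class d l H \<Delta>" and Q: "grad_oracle d F s Q"
  shows "integrable (multi_acsa d Q ss (origin d)) F"
    and "(LINT x|multi_acsa d Q ss (origin d). F x) - opt_val d F \<le> A * (F (origin d) - opt_val d F) + B"
proof -
  interpret noisy_problem d F l H s Q
    using F Q l by unfold_locales (simp_all add: fun_class_def)
  let ?M = "multi_acsa d Q ss (origin d)"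
  interpret M: prob_space ?M by (rule multi_acsa_prob) simp
  have le: "(\<integral>\<^sup>+x. ennreal (gap x) \<partial>?M) \<le> ennreal (A * gap (origin d) + B)"
    using ach noisy_problem_axioms unfolding achieves_def by simp
  have "space ?M = rvec d" using sets_eq_imp_space_eq[OF multi_acsa_sets[of "origin d" ss]] by simp
  then have nonneg: "AE x in ?M. 0 \<le> gap x" using gap_nonneg by (intro AE_I2) simp
  have meas: "F \<in> borel_measurable ?M" using measurable_F by (simp cong: measurable_cong_sets)
  \<comment> \<open>The gap is nonnegative with finite nonnegative integral, hence integrable, and F
    differs from it by a constant.\<close>
  have int: "integrable ?M gap"
    by (rule integrableI_nonneg[OF _ nonneg order_le_less_trans[OF le]]) (use meas in simp_all)
  have "integrable ?M (\<lambda>x. gap x + opt_val d F)"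
    using int by (intro Bochner_Integration.integrable_add) simp_all
  then show intF: "integrable ?M F" by simp
  have "ennreal (LINT x|?M. gap x) \<le> ennreal (A * gap (origin d) + B)"
    using le nn_integral_eq_integral[OF int nonneg] by simp
  then have "(LINT x|?M. gap x) \<le> A * gap (origin d) + B"
    using AB gap_nonneg[OF origin_rvec] by (subst (asm) ennreal_le_iff) auto
  then show "(LINT x|?M. F x) - opt_val d F \<le> A * gap (origin d) + B"
    using intF by (simp add: M.prob_space)
qed

lemma achieves_guarantees:
  assumes ach: "achieves l H \<sigma> ss A B" and l: "0 < l" and AB: "0 \<le> A" "0 \<le> B" and C: "A * \<Delta> + B \<le> C"
  shows "guarantees (\<lambda>d. single_machine_acsa d ss) H l \<Delta> \<sigma> C"
  unfolding guarantees_def single_machine_acsa_def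
proof (intro allI ballI impI conjI)
  fix d F Q assume F: "F \<in> fun_class d l H \<Delta>" and Q: "grad_oracle d F \<sigma> Q"
  note * = achieves_expected_gap[OF ach l AB F Q]
  show "integrable (multi_acsa d Q ss (origin d)) F" by (rule *)
  have "A * (F (origin d) - opt_val d F) \<le> A * \<Delta>"
    using F AB by (intro mult_left_mono) (simp_all add: fun_class_def)
  with *(2) C show "(LINT x|multi_acsa d Q ss (origin d). F x) - opt_val d F \<le> C" by linarith
qed

text \<open>A minibatch run is the single-machine recursion on the averaged oracle, whose noise is
  \<open>\<sigma> / sqrt (M * K)\<close>.\<close>

lemma guarantees_minibatch:
  assumes "guarantees (\<lambda>d. single_machine_acsa d ss) H l \<Delta> (\<sigma> / sqrt (real M * real K)) C"
    and "1 \<le> M" "1 \<le> K"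
  shows "guarantees (\<lambda>d. minibatch_acsa d M K ss) H l \<Delta> \<sigma> C"
  using assms grad_oracle_minibatch
  unfolding guarantees_def single_machine_acsa_def minibatch_acsa_def by meson

text \<open>For \<open>H < l\<close> the class is empty except in dimension \<open>0\<close>, where every point is optimal.\<close>

lemma guarantees_ill_conditioned:
  assumes l: "0 < l" and H: "H < l" and C: "0 \<le> C"
  shows "guarantees (\<lambda>d. single_machine_acsa d (idle N)) H l \<Delta> \<sigma> C"
  unfolding guarantees_def single_machine_acsa_def
proof (intro allI ballI impI conjI)
  fix d F Q assume F: "F \<in> fun_class d l H \<Delta>" and Q: "grad_oracle d F \<sigma> Q"
  have "d = 0"
    using strong_convexity_le_smoothness[OF l, of d F H] F H by (auto simp: fun_class_def)
  then have "F (origin d) = opt_val d F"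
    by (simp add: opt_val_def origin_def restrict_def)
  with achieves_expected_gap[OF achieves_idle l _ _ F Q, of N] C
  show "integrable (multi_acsa d Q (idle N) (origin d)) F"
    "(LINT x|multi_acsa d Q (idle N) (origin d). F x) - opt_val d F \<le> C"
    by auto
qed

theorem theorem14:
  shows "\<exists>c>0. \<exists>c'>0. \<forall>(M::nat) (K::nat) (R::nat) (H::real) (\<Delta>::real) (l::real) (\<sigma>::real).
    M \<ge> 1 \<and> K \<ge> 1 \<and> R \<ge> 1 \<and> H > 0 \<and> \<Delta> > 0 \<and> l > 0 \<and> \<sigma> \<ge> 0 \<longrightarrow>
    (let B = c * (\<Delta> * exp (- (c' * sqrt l * real K * real R / sqrt H))
               + min (\<sigma>\<^sup>2 / (l * real M * real K * real R)) \<Delta>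
               + min (\<sigma>\<^sup>2 / (l * real K * real R)) (\<Delta> * exp (- (c' * sqrt l * real R / sqrt H))))
     in (\<exists>ss. valid_schedule R ss \<and>
              guarantees (\<lambda>d. minibatch_acsa d M K ss) H l \<Delta> \<sigma> B) \<or>
        (\<exists>ss. valid_schedule (K * R) ss \<and>
              guarantees (\<lambda>d. single_machine_acsa d ss) H l \<Delta> \<sigma> B))"
proof (rule exI[of _ 256], rule conjI[OF _ exI[of _ "1 / 42"]], simp, rule conjI, simp, intro allI impI)
  fix M K R :: nat and H \<Delta> l \<sigma> :: real
  assume prem: "M \<ge> 1 \<and> K \<ge> 1 \<and> R \<ge> 1 \<and> H > 0 \<and> \<Delta> > 0 \<and> l > 0 \<and> \<sigma> \<ge> 0"
  then have H: "0 < H" and \<Delta>: "0 < \<Delta>" and l: "0 < l" and MK: "1 \<le> M" "1 \<le> K" by auto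
  define e1 where "e1 = exp (- (1 / 42 * sqrt l * real K * real R / sqrt H))"
  define e2 where "e2 = exp (- (1 / 42 * sqrt l * real R / sqrt H))"
  define v1 where "v1 = \<sigma>\<^sup>2 / (l * real M * real K * real R)"
  define v2 where "v2 = \<sigma>\<^sup>2 / (l * real K * real R)"
  \<comment> \<open>Both constants are those of \<open>exists_schedule\<close>; 256 also covers its
    factor 2 in front of the exponential.\<close>
  define B where "B = 256 * (\<Delta> * e1 + min v1 \<Delta> + min v2 (\<Delta> * e2))"
  have pos: "0 < \<Delta> * e1" "0 < \<Delta> * e2" "0 \<le> v1" "0 \<le> v2"
    using l \<Delta> by (simp_all add: e1_def e2_def v1_def v2_def)
  have "(\<exists>ss. valid_schedule R ss \<and> guarantees (\<lambda>d. minibatch_acsa d M K ss) H l \<Delta> \<sigma> B) \<or>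
      (\<exists>ss. valid_schedule (K * R) ss \<and> guarantees (\<lambda>d. single_machine_acsa d ss) H l \<Delta> \<sigma> B)"
    (is "?mini \<or> ?single")
  proof (cases "H < l")
    case True
    have "0 \<le> B" using pos \<Delta> by (simp add: B_def)
    then have ?single using guarantees_ill_conditioned[OF l True] valid_schedule_idle by blast
    then show ?thesis ..
  next
    case False
    then have lH: "l \<le> H" by simp
    show ?thesis
    proof (cases "v2 \<le> \<Delta> * e2")
      \<comment> \<open>Here the last minimum in \<open>B\<close> is \<open>v2\<close>, the noise
        term of a single machine with \<open>K * R\<close> steps, whose exponential is
        \<open>e1\<close>.\<close>
      case True
      obtain ss where ss: "valid_schedule (K * R) ss" "achieves l H \<sigma> ss (2 * e1) (256 * v2)"
        using exists_schedule[OF l H lH, of "K * R" \<sigma>] by (auto simp: e1_def v2_def mult.assoc)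
      have "2 * e1 * \<Delta> + 256 * v2 \<le> B" using True pos \<Delta> by (simp add: B_def mult.commute)
      then have "guarantees (\<lambda>d. single_machine_acsa d ss) H l \<Delta> \<sigma> B"
        using pos by (intro achieves_guarantees[OF ss(2) l]) (simp_all add: e1_def)
      then show ?thesis using ss(1) by blast
    next
      \<comment> \<open>Now the last minimum is \<open>\<Delta> * e2\<close>, which pays for the
        slower exponential of only R minibatch steps.\<close>
      case large_variance: False
      have "\<exists>ss A b. valid_schedule R ss \<and> achieves l H (\<sigma> / sqrt (real M * real K)) ss A b \<and>
          0 \<le> A \<and> 0 \<le> b \<and> A * \<Delta> + b \<le> B"
      proof (cases "v1 \<le> \<Delta>")
        case True
        have "2 * e2 * \<Delta> + 256 * v1 \<le> B"
          using True large_variance pos by (simp add: B_def mult.commute)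
        \<comment> \<open>The reduced noise contributes the missing factor: its square over
          \<open>l * R\<close> is \<open>v1\<close>.\<close>
        moreover obtain ss where "valid_schedule R ss"
          "achieves l H (\<sigma> / sqrt (real M * real K)) ss (2 * e2) (256 * v1)"
          using exists_schedule[OF l H lH, of R "\<sigma> / sqrt (real M * real K)"]
          by (auto simp: e2_def v1_def power_divide mult_ac)
        moreover have "0 \<le> 2 * e2" "0 \<le> 256 * v1" using pos by (simp_all add: e2_def)
        ultimately show ?thesis by blast
      next
        \<comment> \<open>The middle minimum equals \<open>\<Delta>\<close>, so staying at the
          origin is good enough.\<close>
        case False
        then have "1 * \<Delta> + 0 \<le> B" using pos \<Delta> by (simp add: B_def)
        then show ?thesis using achieves_idle valid_schedule_idle
          by (intro exI[of _ "idle R"] exI[of _ 1] exI[of _ 0]) auto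
      qed
      then show ?thesis using achieves_guarantees[OF _ l] guarantees_minibatch[OF _ MK] by blast
    qed
  qed
  then show "let B = 256 * (\<Delta> * exp (- (1 / 42 * sqrt l * real K * real R / sqrt H))
               + min (\<sigma>\<^sup>2 / (l * real M * real K * real R)) \<Delta>
               + min (\<sigma>\<^sup>2 / (l * real K * real R)) (\<Delta> * exp (- (1 / 42 * sqrt l * real R / sqrt H))))
     in (\<exists>ss. valid_schedule R ss \<and>
              guarantees (\<lambda>d. minibatch_acsa d M K ss) H l \<Delta> \<sigma> B) \<or>
        (\<exists>ss. valid_schedule (K * R) ss \<and>
              guarantees (\<lambda>d. single_machine_acsa d ss) H l \<Delta> \<sigma> B)"
    by (simp only: Let_def B_def e1_def e2_def v1_def v2_def)
qed

end
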